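(* Let $\beta\in(0,2\pi)$. Let $G(t)$, $t>0$, be a function and let $g$ be given by $$g(x)=-\frac{16x}{\pi}\int_0^\infty\mathrm{Im}\left[\Gamma(1+2ix)\left[\mathrm{ber}^2_{2ix}\left(2(4t)^{1/4}\right)+\mathrm{bei}^2_{2ix}\left(2(4t)^{1/4}\right)\right]\right]dG(t),$$ where $G$ is the transform of $g$, i.e. $$G(t)=(Gg)(t)=\int_0^\infty\left[\mathrm{ker}^2_{2i\tau}\left(2(4t)^{1/4}\right)+\mathrm{kei}^2_{2i\tau}\left(2(4t)^{1/4}\right)\right]g(\tau)\,d\tau,\qquad t>0,$$ and suppose that the following conditions hold for some $0<\mu<1/2$, with $D=\{z\in\mathbb{C}:|\mathrm{Re}\,z|\le\mu\}$: (i) $g(z/i)$ is an even analytic function of $z$ in $D$, $g(0)=g'(0)=0$, and $e^{-3\pi|\mathrm{Im}\,z|/2}g(z/i)$ is absolutely integrable over any vertical line in $D$; (ii) $g\in L_1(\mathbb{R}_+;d\tau)$ and $G\in L_{\gamma,1}(\mathbb{R}_+)$ for some $0<\gamma<1/2$ such that the line $\mathrm{Re}\,s=\gamma$ lies in $D$; (iii) the Mellin transform $G^*(s)$ is analytic in $D$ and, for every vertical line $\mathrm{Re}\,s=\nu$ in $D$, $|s|^{1/2-2\nu}e^{\pi|s|/2}G^*(s)\in L_1(\nu-i\infty,\nu+i\infty)$. Then the function $$u(r,\theta)=\int_0^\infty\left[\mathrm{ker}^2_{2i\tau}\left(2(4r)^{1/4}\right)+\mathrm{kei}^2_{2i\tau}\left(2(4r)^{1/4}\right)\right]\frac{\sinh(\theta\tau)}{\sinh(\beta\tau)}\,g(\tau)\,d\tau,\qquad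 r>0,\ 0\le\theta\le\beta,$$ is a solution of the boundary value problem for the partial differential equation $$r^3\frac{\partial^4u}{\partial r^4}+r\frac{\partial^4u}{\partial r^2\partial\theta^2}+\frac{11}{2}r^2\frac{\partial^3u}{\partial r^3}+\frac12\frac{\partial^3u}{\partial r\,\partial\theta^2}+\frac{11}{2}r\frac{\partial^2u}{\partial r^2}+\frac12\frac{\partial u}{\partial r}-u=0$$ subject to the conditions $$u(r,0)=0,\qquad u(r,\beta)=G(r).$$
   Context: $\mathbb{R}_+=(0,\infty)$; functions are complex-valued; $\mathrm{Im}$ is the imaginary part; $\Gamma$ is Euler's gamma function. $L_{\gamma,1}(\mathbb{R}_+)$ is the space of measurable $f$ with $\int_0^\infty|f(x)|x^{\gamma-1}dx<\infty$. The Mellin transform is $f^*(s)=\int_0^\infty f(x)x^{s-1}dx$ (here on the line $\mathrm{Re}\,s=\gamma$, and by analytic continuation elsewhere in $D$). $L_1(\nu-i\infty,\nu+i\infty)$ denotes the functions absolutely integrable over the vertical line $\mathrm{Re}\,s=\nu$. The values $g(\tau)$, $\tau\in\mathbb{R}$, are those of $z\mapsto g(z/i)$ at $z=i\tau$. $dG(t)$ is the differential of $G$, i.e. $G'(t)\,dt$. $K_\nu$ and $I_\nu$ are the modified Bessel functions of the second and first kind, where $K_\nu(z)=\int_0^\infty e^{-z\cosh y}\cosh(\nu y)\,dy$ for $\mathrm{Re}\,z>0$; $J_\nu$ is the Bessel function of the first kind. For $x>0$ and complex $\nu$ the Kelvin functions are defined by the pairs of equations $$\mathrm{ker}_\nu(x)\pm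 i\,\mathrm{kei}_\nu(x)=e^{\mp\nu\pi i/2}K_\nu\left(xe^{\pm\pi i/4}\right),$$ $$\mathrm{ber}_\nu(x)\pm i\,\mathrm{bei}_\nu(x)=e^{\pm\nu\pi i}J_\nu\left(xe^{\mp\pi i/4}\right)=e^{\pm\nu\pi i/2}I_\nu\left(xe^{\pm\pi i/4}\right).$$ *)

theory Defs
  imports "HOL-Complex_Analysis.Complex_Analysis"
begin

subsection \<open>Bessel and Kelvin functions of complex order\<close>

text \<open>
  The powers \<open>(z/2)\<^sup>\<nu>\<close> are principal branches. The reciprocal Gamma function is entire, so the series
  are meaningful for every complex order.
\<close>

definition bessel_J :: "complex \<Rightarrow> complex \<Rightarrow> complex" where
  "bessel_J \<nu> z =
     (z / 2) powr \<nu> * (\<Sum>k. (-1) ^ k * (z / 2) ^ (2 * k) / fact k * rGamma (\<nu> + of_nat k + 1))"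

definition bessel_I :: "complex \<Rightarrow> complex \<Rightarrow> complex" where
  "bessel_I \<nu> z =
     (z / 2) powr \<nu> * (\<Sum>k. (z / 2) ^ (2 * k) / fact k * rGamma (\<nu> + of_nat k + 1))"

text \<open>The integral converges, and defines the Macdonald function, only for \<open>Re z > 0\<close>.\<close>

definition bessel_K :: "complex \<Rightarrow> complex \<Rightarrow> complex" where
  "bessel_K \<nu> z =
     integral {0<..} (\<lambda>y. exp (- z * complex_of_real (cosh y)) * cosh (\<nu> * complex_of_real y))"

text \<open>
  For non-real order these are not real and imaginary parts: each pair is the solution of a linear
  \<open>2 \<times> 2\<close> system, see \<open>ker_kei_pair\<close>, \<open>ber_bei_pair_J\<close> and \<open>ber_bei_pair_I\<close> below.
\<close>

definition kelvin_ker :: "complex \<Rightarrow> real \<Rightarrow> complex" where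
  "kelvin_ker \<nu> x =
     (exp (- (\<nu> * of_real pi * \<i> / 2)) * bessel_K \<nu> (of_real x * cis (pi / 4)) +
      exp (\<nu> * of_real pi * \<i> / 2) * bessel_K \<nu> (of_real x * cis (- pi / 4))) / 2"

definition kelvin_kei :: "complex \<Rightarrow> real \<Rightarrow> complex" where
  "kelvin_kei \<nu> x =
     (exp (- (\<nu> * of_real pi * \<i> / 2)) * bessel_K \<nu> (of_real x * cis (pi / 4)) -
      exp (\<nu> * of_real pi * \<i> / 2) * bessel_K \<nu> (of_real x * cis (- pi / 4))) / (2 * \<i>)"

definition kelvin_ber :: "complex \<Rightarrow> real \<Rightarrow> complex" where
  "kelvin_ber \<nu> x =
     (exp (\<nu> * of_real pi * \<i>) * bessel_J \<nu> (of_real x * cis (- pi / 4)) +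
      exp (- (\<nu> * of_real pi * \<i>)) * bessel_J \<nu> (of_real x * cis (pi / 4))) / 2"

definition kelvin_bei :: "complex \<Rightarrow> real \<Rightarrow> complex" where
  "kelvin_bei \<nu> x =
     (exp (\<nu> * of_real pi * \<i>) * bessel_J \<nu> (of_real x * cis (- pi / 4)) -
      exp (- (\<nu> * of_real pi * \<i>)) * bessel_J \<nu> (of_real x * cis (pi / 4))) / (2 * \<i>)"

lemma ker_kei_pair:
  "kelvin_ker \<nu> x + \<i> * kelvin_kei \<nu> x =
     exp (- (\<nu> * of_real pi * \<i> / 2)) * bessel_K \<nu> (of_real x * cis (pi / 4))"
  "kelvin_ker \<nu> x - \<i> * kelvin_kei \<nu> x =
     exp (\<nu> * of_real pi * \<i> / 2) * bessel_K \<nu> (of_real x * cis (- pi / 4))"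
  by (simp_all add: kelvin_ker_def kelvin_kei_def field_simps)

lemma ber_bei_pair_J:
  "kelvin_ber \<nu> x + \<i> * kelvin_bei \<nu> x =
     exp (\<nu> * of_real pi * \<i>) * bessel_J \<nu> (of_real x * cis (- pi / 4))"
  "kelvin_ber \<nu> x - \<i> * kelvin_bei \<nu> x =
     exp (- (\<nu> * of_real pi * \<i>)) * bessel_J \<nu> (of_real x * cis (pi / 4))"
  by (simp_all add: kelvin_ber_def kelvin_bei_def field_simps)

lemma powr_polar:
  assumes "x > 0" "- pi < a" "a \<le> pi"
  shows "(complex_of_real x * cis a / 2) powr \<nu> = exp (\<nu> * (of_real (ln (x / 2)) + \<i> * of_real a))"
proof -
  have "complex_of_real x * cis a / 2 = exp (of_real (ln (x / 2)) + \<i> * of_real a)"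
    using assms by (simp add: exp_add cis_conv_exp exp_of_real)
  moreover have "Ln (exp (of_real (ln (x / 2)) + \<i> * of_real a)) = of_real (ln (x / 2)) + \<i> * of_real a"
    using assms by (intro Ln_exp) auto
  ultimately show ?thesis
    using assms by (simp add: powr_def)
qed

lemma ber_bei_pair_I:
  assumes "x > 0"
  shows
  "kelvin_ber \<nu> x + \<i> * kelvin_bei \<nu> x =
     exp (\<nu> * of_real pi * \<i> / 2) * bessel_I \<nu> (of_real x * cis (pi / 4))"
  "kelvin_ber \<nu> x - \<i> * kelvin_bei \<nu> x =
     exp (- (\<nu> * of_real pi * \<i> / 2)) * bessel_I \<nu> (of_real x * cis (- pi / 4))"
proof -
  have sq: "(complex_of_real x * cis a / 2)\<^sup>2 = - ((complex_of_real x * cis b / 2)\<^sup>2)"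
    if "2 * b = 2 * a + pi \<or> 2 * b = 2 * a - pi" for a b :: real
  proof -
    have "cis (2 * a) = - cis (2 * b)"
      using that by (auto simp: cis.code cos_add sin_add cos_diff sin_diff complex_eq_iff)
    then show ?thesis
      by (simp add: power_divide power_mult_distrib Complex.DeMoivre)
  qed
  have ser: "(-1) ^ k * (complex_of_real x * cis a / 2) ^ (2 * k) = (complex_of_real x * cis b / 2) ^ (2 * k)"
    if "2 * b = 2 * a + pi \<or> 2 * b = 2 * a - pi" for a b :: real and k
    unfolding power_mult sq[OF that] power_mult_distrib[symmetric] by simp
  have polar:
    "(complex_of_real x * cis (pi / 4) / 2) powr \<nu> = exp (\<nu> * (of_real (ln (x / 2)) + \<i> * of_real (pi / 4)))"
    "(complex_of_real x * cis (- pi / 4) / 2) powr \<nu> = exp (\<nu> * (of_real (ln (x / 2)) + \<i> * of_real (- pi / 4)))"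
    using assms pi_gt_zero by (intro powr_polar; linarith)+
  have "exp (\<nu> * of_real pi * \<i>) * (complex_of_real x * cis (- pi / 4) / 2) powr \<nu> =
        exp (\<nu> * of_real pi * \<i> / 2) * (complex_of_real x * cis (pi / 4) / 2) powr \<nu>"
    unfolding polar exp_add[symmetric] by (rule arg_cong[where f = exp]) (simp add: field_simps)
  then show "kelvin_ber \<nu> x + \<i> * kelvin_bei \<nu> x =
     exp (\<nu> * of_real pi * \<i> / 2) * bessel_I \<nu> (of_real x * cis (pi / 4))"
    using ser[of "pi / 4" "- pi / 4"]
    unfolding ber_bei_pair_J bessel_J_def bessel_I_def by (simp add: mult.assoc[symmetric])
  have "exp (- (\<nu> * of_real pi * \<i>)) * (complex_of_real x * cis (pi / 4) / 2) powr \<nu> =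
        exp (- (\<nu> * of_real pi * \<i> / 2)) * (complex_of_real x * cis (- pi / 4) / 2) powr \<nu>"
    unfolding polar exp_add[symmetric] by (rule arg_cong[where f = exp]) (simp add: field_simps)
  then show "kelvin_ber \<nu> x - \<i> * kelvin_bei \<nu> x =
     exp (- (\<nu> * of_real pi * \<i> / 2)) * bessel_I \<nu> (of_real x * cis (- pi / 4))"
    using ser[of "- pi / 4" "pi / 4"]
    unfolding ber_bei_pair_J bessel_J_def bessel_I_def by (simp add: mult.assoc[symmetric])
qed

text \<open>The squared Kelvin functions of order \<open>2i\<tau>\<close> at the argument \<open>2(4t)\<^bsup>1/4\<^esup>\<close>.\<close>

definition kernel_K :: "real \<Rightarrow> real \<Rightarrow> complex" where
  "kernel_K \<tau> t =
     (kelvin_ker (2 * \<i> * of_real \<tau>) (2 * (4 * t) powr (1 / 4)))\<^sup>2 +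
     (kelvin_kei (2 * \<i> * of_real \<tau>) (2 * (4 * t) powr (1 / 4)))\<^sup>2"

definition kernel_B :: "real \<Rightarrow> real \<Rightarrow> complex" where
  "kernel_B \<tau> t =
     (kelvin_ber (2 * \<i> * of_real \<tau>) (2 * (4 * t) powr (1 / 4)))\<^sup>2 +
     (kelvin_bei (2 * \<i> * of_real \<tau>) (2 * (4 * t) powr (1 / 4)))\<^sup>2"

subsection \<open>Mellin transform and function spaces\<close>

text \<open>
  Integrals are gauge integrals; they agree with Lebesgue integrals on absolutely integrable
  functions and with convergent improper integrals otherwise.
\<close>

definition mellin :: "(real \<Rightarrow> complex) \<Rightarrow> complex \<Rightarrow> complex" where
  "mellin f s = integral {0<..} (\<lambda>x. f x * of_real x powr (s - 1))"

definition L_weighted :: "real \<Rightarrow> (real \<Rightarrow> complex) set" where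
  "L_weighted \<gamma> = {f. (\<lambda>x. f x * of_real (x powr (\<gamma> - 1))) absolutely_integrable_on {0<..}}"

definition abs_integrable_on_line :: "(complex \<Rightarrow> complex) \<Rightarrow> real \<Rightarrow> bool" where
  "abs_integrable_on_line f \<nu> \<longleftrightarrow> (\<lambda>y. f (Complex \<nu> y)) absolutely_integrable_on UNIV"

definition vstrip :: "real \<Rightarrow> complex set" where
  "vstrip \<mu> = {z. \<bar>Re z\<bar> \<le> \<mu>}"

subsection \<open>The differential equation\<close>

definition pd_r :: "(real \<Rightarrow> real \<Rightarrow> complex) \<Rightarrow> real \<Rightarrow> real \<Rightarrow> complex" where
  "pd_r u r \<theta> = vector_derivative (\<lambda>\<rho>. u \<rho> \<theta>) (at r)"

definition pd_\<theta> :: "(real \<Rightarrow> real \<Rightarrow> complex) \<Rightarrow> real \<Rightarrow> real \<Rightarrow> complex" where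
  "pd_\<theta> u r \<theta> = vector_derivative (\<lambda>\<phi>. u r \<phi>) (at \<theta>)"

text \<open>
  The derivative of order \<open>i + j\<close> taken \<open>j\<close> times in \<open>\<theta>\<close> and then \<open>i\<close> times in \<open>r\<close>.
\<close>

definition pd :: "nat \<Rightarrow> nat \<Rightarrow> (real \<Rightarrow> real \<Rightarrow> complex) \<Rightarrow> real \<Rightarrow> real \<Rightarrow> complex" where
  "pd i j u = (pd_r ^^ i) ((pd_\<theta> ^^ j) u)"

text \<open>
  The three differentiability clauses say that every derivative in the equation exists, so that
  \<^const>\<open>vector_derivative\<close> never takes an arbitrary value.
\<close>

definition solves_pde :: "real \<Rightarrow> (real \<Rightarrow> real \<Rightarrow> complex) \<Rightarrow> bool" where
  "solves_pde \<beta> u \<longleftrightarrow> (\<forall>r \<theta>. 0 < r \<and> 0 < \<theta> \<and> \<theta> < \<beta> \<longrightarrow>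
     (\<forall>i<4. (\<lambda>\<rho>. pd i 0 u \<rho> \<theta>) differentiable at r) \<and>
     (\<forall>j<2. (\<lambda>\<phi>. pd 0 j u r \<phi>) differentiable at \<theta>) \<and>
     (\<forall>i<2. (\<lambda>\<rho>. pd i 2 u \<rho> \<theta>) differentiable at r) \<and>
     of_real (r ^ 3) * pd 4 0 u r \<theta>
       + of_real r * pd 2 2 u r \<theta>
       + 11 / 2 * of_real (r ^ 2) * pd 3 0 u r \<theta>
       + 1 / 2 * pd 1 2 u r \<theta>
       + 11 / 2 * of_real r * pd 2 0 u r \<theta>
       + 1 / 2 * pd 1 0 u r \<theta>
       - u r \<theta> = 0)"

end

theory Submission
  imports Defs "HOL-Real_Asymp.Real_Asymp"
begin

text \<open>
  The kernel is the product \<open>K\<^sub>\<nu>(x e\<^bsup>i\<pi>/4\<^esup>) K\<^sub>\<nu>(x e\<^bsup>-i\<pi>/4\<^esup>)\<close> with \<open>\<nu> = 2i\<tau>\<close> and \<open>x = 2(4r)\<^bsup>1/4\<^esup>\<close>. Bessel's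
  equation for the two factors yields, with \<open>D = r d/dr\<close>, the equation
  \<open>(D - 1/2) D (D\<^sup>2 + \<tau>\<^sup>2) \<Phi> = r \<Phi>\<close> for the kernel \<open>\<Phi>\<close>. Since \<open>sinh (\<theta>\<tau>)\<close> is an eigenfunction of
  \<open>\<partial>\<^sup>2/\<partial>\<theta>\<^sup>2\<close> with eigenvalue \<open>\<tau>\<^sup>2\<close>, the integrand of \<open>u\<close> solves the partial differential equation for
  every \<open>\<tau>\<close>. Differentiation under the integral sign is justified by extending \<open>r\<close> and \<open>\<theta>\<close> to complex
  variables: for real \<open>\<tau>\<close> the kernel is bounded locally uniformly in \<open>r\<close> and uniformly in \<open>\<tau>\<close>, and the
  quotient of hyperbolic sines is bounded too, so integrability of \<open>g\<close> dominates the integrand and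
  Cauchy's estimates dominate all of its derivatives.
\<close>

subsection \<open>Holomorphic parameter integrals\<close>

text \<open>Domination and holomorphy are required at every point of the space, not almost
  everywhere, so that Cauchy's estimates apply to each \<open>x\<close> separately. One
  \<open>h\<close> serves a whole ball around \<open>z\<close>, which lets the condition pass on to
  derivatives.\<close>

definition dominated_holomorphic ::
    "'a measure \<Rightarrow> complex set \<Rightarrow> (complex \<Rightarrow> 'a \<Rightarrow> complex) \<Rightarrow> bool" where
  "dominated_holomorphic M S f \<longleftrightarrow>
     open S \<and> (\<forall>z\<in>S. f z \<in> borel_measurable M) \<and>
     (\<forall>x\<in>space M. (\<lambda>z. f z x) holomorphic_on S) \<and>
     (\<forall>z\<in>S. \<exists>e>0. \<exists>h. integrable M h \<and> ball z e \<subseteq> S \<and>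
        (\<forall>w\<in>ball z e. \<forall>x\<in>space M. norm (f w x) \<le> h x))"

lemma dominated_holomorphic_open:
  assumes "dominated_holomorphic M S f"
  shows "open S"
  using assms unfolding dominated_holomorphic_def by (rule conjunct1)

lemma dominated_holomorphic_measurable:
  assumes "dominated_holomorphic M S f" "z \<in> S"
  shows "f z \<in> borel_measurable M"
  using assms(1) unfolding dominated_holomorphic_def by (elim conjE) (erule bspec[OF _ assms(2)])

lemma dominated_holomorphic_holomorphic:
  assumes "dominated_holomorphic M S f" "x \<in> space M"
  shows "(\<lambda>z. f z x) holomorphic_on S"
  using assms(1) unfolding dominated_holomorphic_def by (elim conjE) (erule bspec[OF _ assms(2)])

lemma dominated_holomorphic_bound:
  assumes "dominated_holomorphic M S f" "z \<in> S"
  obtains e h where "e > 0" "integrable M h" "ball z e \<subseteq> S"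
    "\<And>w x. w \<in> ball z e \<Longrightarrow> x \<in> space M \<Longrightarrow> norm (f w x) \<le> h x"
proof -
  have "\<exists>e>0. \<exists>h. integrable M h \<and> ball z e \<subseteq> S \<and>
        (\<forall>w\<in>ball z e. \<forall>x\<in>space M. norm (f w x) \<le> h x)"
    using assms(1) unfolding dominated_holomorphic_def
    by (elim conjE) (erule bspec[where x = z, OF _ assms(2)])
  then obtain e h where *: "e > 0" "integrable M h" "ball z e \<subseteq> S"
      and le: "\<forall>w\<in>ball z e. \<forall>x\<in>space M. norm (f w x) \<le> h x"
    by (elim exE conjE) (rule that)
  show ?thesis
    by (rule that[OF *]) (rule le[THEN bspec, THEN bspec])
qed

lemma dominated_holomorphic_integrable:
  assumes "dominated_holomorphic M S f" "z \<in> S"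
  shows "integrable M (f z)"
proof -
  obtain e h where e: "e > 0" and h: "integrable M h"
    and le: "\<And>w x. w \<in> ball z e \<Longrightarrow> x \<in> space M \<Longrightarrow> norm (f w x) \<le> h x"
    by (rule dominated_holomorphic_bound[OF assms]) (rule that)
  have "norm (f z x) \<le> norm (h x)" if "x \<in> space M" for x
    using le[of z x] e that by simp
  then have "AE x in M. norm (f z x) \<le> norm (h x)"
    by (rule AE_I2)
  then show ?thesis
    by (rule Bochner_Integration.integrable_bound[OF h dominated_holomorphic_measurable[OF assms]])
qed

text \<open>Cauchy's estimate on discs of radius \<open>e / 2\<close>: for centres in
  \<open>ball z (e / 2)\<close> they stay inside \<open>ball z e\<close>, where \<open>h\<close> is
  a bound, so halving the radius costs only the factor \<open>2 / e\<close>.\<close>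

lemma dominated_holomorphic_deriv_bound:
  assumes f: "dominated_holomorphic M S f" and z: "z \<in> S"
  obtains e h where "e > 0" "integrable M h" "ball z e \<subseteq> S"
    "\<And>w x. w \<in> ball z e \<Longrightarrow> x \<in> space M \<Longrightarrow> norm (deriv (\<lambda>w. f w x) w) \<le> h x"
proof -
  obtain e h where e: "e > 0" and h: "integrable M h" and sub: "ball z e \<subseteq> S"
    and le: "\<And>w x. w \<in> ball z e \<Longrightarrow> x \<in> space M \<Longrightarrow> norm (f w x) \<le> h x"
    by (rule dominated_holomorphic_bound[OF assms]) (rule that)
  have "norm (deriv (\<lambda>w. f w x) w) \<le> h x / (e / 2)"
    if w: "w \<in> ball z (e / 2)" and x: "x \<in> space M" for w x
  proof -
    have hol: "(\<lambda>w. f w x) holomorphic_on S"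
      using dominated_holomorphic_holomorphic[OF f x] .
    have ball: "v \<in> ball z e" if "dist w v \<le> e / 2" for v
      using w that dist_triangle[of z v w] by simp
    then have cb: "cball w (e / 2) \<subseteq> S"
      using sub by (auto simp: subset_iff)
    have "norm ((deriv ^^ 1) (\<lambda>w. f w x) w) \<le> fact 1 * h x / (e / 2) ^ 1"
    proof (rule Cauchy_inequality)
      show "(\<lambda>w. f w x) holomorphic_on ball w (e / 2)"
        using cb ball_subset_cball by (blast intro: holomorphic_on_subset[OF hol])
      show "continuous_on (cball w (e / 2)) (\<lambda>w. f w x)"
        using cb by (blast intro: holomorphic_on_imp_continuous_on holomorphic_on_subset[OF hol])
      show "norm (f v x) \<le> h x" if "norm (w - v) = e / 2" for v
        using that x by (intro le ball) (auto simp: dist_norm)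
    qed (use e in auto)
    then show ?thesis by simp
  qed
  moreover have "integrable M (\<lambda>x. h x / (e / 2))" "ball z (e / 2) \<subseteq> S"
    using h sub e by (auto simp: subset_iff)
  ultimately show ?thesis
    using e by (intro that[of "e / 2" "\<lambda>x. h x / (e / 2)"]) auto
qed

text \<open>Closure under differentiation gives all orders by induction. Beyond the bound, the point
  is measurability: the derivative is a pointwise limit of measurable difference quotients.\<close>

lemma dominated_holomorphic_deriv:
  assumes f: "dominated_holomorphic M S f"
  shows "dominated_holomorphic M S (\<lambda>z x. deriv (\<lambda>w. f w x) z)"
  unfolding dominated_holomorphic_def
proof (intro conjI ballI)
  show S: "open S" using f by (rule dominated_holomorphic_open)
  have hol: "(\<lambda>w. f w x) holomorphic_on S" if "x \<in> space M" for x
    using dominated_holomorphic_holomorphic[OF f that] .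
  show "(\<lambda>z. deriv (\<lambda>w. f w x) z) holomorphic_on S" if "x \<in> space M" for x
    using hol[OF that] S by (intro holomorphic_intros)
  fix z assume z: "z \<in> S"
  show "\<exists>e>0. \<exists>h. integrable M h \<and> ball z e \<subseteq> S \<and>
      (\<forall>w\<in>ball z e. \<forall>x\<in>space M. norm (deriv (\<lambda>w. f w x) w) \<le> h x)"
    by (rule dominated_holomorphic_deriv_bound[OF f z], intro exI conjI ballI) assumption+
  obtain e where e: "e > 0" "ball z e \<subseteq> S"
    using S z open_contains_ball by blast
  \<comment> \<open>A nonzero null sequence of increments; the scaling by \<open>e / 2\<close> keeps
    \<open>z + t n\<close> inside the ball, hence in \<open>S\<close>.\<close>
  define t where "t n = complex_of_real (e / 2 * inverse (real (Suc n)))" for n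
  have t0: "t \<longlonglongrightarrow> of_real (e / 2 * 0)"
    unfolding t_def by (intro tendsto_intros LIMSEQ_inverse_real_of_nat)
  have norm_t: "norm (t n) \<le> e / 2 \<and> t n \<noteq> 0" for n
  proof -
    have "norm (t n) = e / 2 * inverse (real (Suc n))"
      using e by (simp only: t_def norm_of_real) simp
    also have "\<dots> \<le> e / 2 * 1"
      using e by (intro mult_left_mono) (auto simp: field_simps)
    finally show ?thesis
      using e by (auto simp: t_def simp del: of_nat_Suc)
  qed
  have tS: "z + t n \<in> S" for n
    using norm_t[of n] e by (intro subsetD[OF e(2)]) (auto simp: dist_norm)
  show "(\<lambda>x. deriv (\<lambda>w. f w x) z) \<in> borel_measurable M"
  proof (rule borel_measurable_LIMSEQ_metric)
    have [measurable]: "f w \<in> borel_measurable M" if "w \<in> S" for w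
      using dominated_holomorphic_measurable[OF f that] .
    show "(\<lambda>x. (f (z + t n) x - f z x) / t n) \<in> borel_measurable M" for n
      using z tS[of n] by measurable
    fix x assume "x \<in> space M"
    then have "((\<lambda>w. f w x) has_field_derivative deriv (\<lambda>w. f w x) z) (at z)"
      using hol S z holomorphic_derivI by blast
    then have "((\<lambda>h. (f (z + h) x - f z x) / h) \<longlongrightarrow> deriv (\<lambda>w. f w x) z) (at 0)"
      by (simp add: DERIV_def)
    then show "(\<lambda>n. (f (z + t n) x - f z x) / t n) \<longlonglongrightarrow> deriv (\<lambda>w. f w x) z"
      using t0 norm_t unfolding tendsto_at_iff_sequentially o_def by auto
  qed
qed

text \<open>Dominated convergence for the difference quotients along an arbitrary null sequence. By
  the mean value inequality on the convex ball, a majorant of the derivative is also one for the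
  quotients.\<close>

lemma dominated_holomorphic_has_field_derivative_integral:
  assumes f: "dominated_holomorphic M S f" and z: "z \<in> S"
  shows "((\<lambda>z. \<integral>x. f z x \<partial>M) has_field_derivative (\<integral>x. deriv (\<lambda>w. f w x) z \<partial>M)) (at z)"
  unfolding DERIV_def tendsto_at_iff_sequentially o_def
proof (intro allI impI)
  fix X :: "nat \<Rightarrow> complex"
  assume X: "\<forall>n. X n \<in> UNIV - {0}" and X0: "X \<longlonglongrightarrow> 0"
  obtain e h where e: "e > 0" and h: "integrable M h" and sub: "ball z e \<subseteq> S"
    and le: "\<And>w x. w \<in> ball z e \<Longrightarrow> x \<in> space M \<Longrightarrow> norm (deriv (\<lambda>w. f w x) w) \<le> h x"
    by (rule dominated_holomorphic_deriv_bound[OF f z]) (rule that)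
  have S: "open S" using f by (rule dominated_holomorphic_open)
  have der: "((\<lambda>w. f w x) has_field_derivative deriv (\<lambda>w. f w x) w) (at w)"
    if "x \<in> space M" "w \<in> S" for x w
    using holomorphic_derivI[OF dominated_holomorphic_holomorphic[OF f that(1)] S that(2)] .
  have [measurable]: "f w \<in> borel_measurable M" if "w \<in> S" for w
    using dominated_holomorphic_measurable[OF f that] .
  have [measurable]: "(\<lambda>x. deriv (\<lambda>w. f w x) z) \<in> borel_measurable M"
    using dominated_holomorphic_measurable[OF dominated_holomorphic_deriv[OF f] z] .
  obtain N where N: "\<And>n. n \<ge> N \<Longrightarrow> norm (X n) < e"
    using X0 e unfolding LIMSEQ_iff by (metis diff_zero)
  \<comment> \<open>Passing to a tail puts all increments in the ball; \<open>LIMSEQ_offset\<close>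
    undoes the shift at the end.\<close>
  define Y where "Y n = X (n + N)" for n
  have Y: "Y n \<noteq> 0" "z + Y n \<in> ball z e" for n
    using X N[of "n + N"] by (auto simp: Y_def dist_norm)
  have zY: "z + Y n \<in> S" for n
    using Y(2) sub by blast
  have Y0: "Y \<longlonglongrightarrow> 0"
    unfolding Y_def by (rule LIMSEQ_ignore_initial_segment[OF X0])
  have "(\<lambda>n. \<integral>x. (f (z + Y n) x - f z x) / Y n \<partial>M) \<longlonglongrightarrow> (\<integral>x. deriv (\<lambda>w. f w x) z \<partial>M)"
  proof (rule integral_dominated_convergence)
    show "(\<lambda>x. (f (z + Y n) x - f z x) / Y n) \<in> borel_measurable M" for n
      using z zY[of n] by measurable
    show "AE x in M. (\<lambda>n. (f (z + Y n) x - f z x) / Y n) \<longlonglongrightarrow> deriv (\<lambda>w. f w x) z"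
    proof (intro AE_I2)
      fix x assume "x \<in> space M"
      from der[OF this z] show "(\<lambda>n. (f (z + Y n) x - f z x) / Y n) \<longlonglongrightarrow> deriv (\<lambda>w. f w x) z"
        using Y0 Y(1) by (simp add: DERIV_def tendsto_at_iff_sequentially o_def)
    qed
    show "AE x in M. norm ((f (z + Y n) x - f z x) / Y n) \<le> h x" for n
    proof (intro AE_I2)
      fix x assume x: "x \<in> space M"
      have "norm (f (z + Y n) x - f z x) \<le> h x * norm (z + Y n - z)"
      proof (rule field_differentiable_bound)
        show "convex (ball z e)" by (rule convex_ball)
        show "z + Y n \<in> ball z e" "z \<in> ball z e" using Y(2) e by simp_all
        fix w assume w: "w \<in> ball z e"
        show "((\<lambda>w. f w x) has_field_derivative deriv (\<lambda>w. f w x) w) (at w within ball z e)"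
          by (rule has_field_derivative_at_within[OF der[OF x subsetD[OF sub w]]])
        show "norm (deriv (\<lambda>w. f w x) w) \<le> h x" by (rule le[OF w x])
      qed
      then show "norm ((f (z + Y n) x - f z x) / Y n) \<le> h x"
        using Y(1)[of n] by (simp add: norm_divide pos_divide_le_eq)
    qed
  qed (use h in measurable)
  moreover have "(\<integral>x. (f (z + Y n) x - f z x) / Y n \<partial>M) =
      ((\<integral>x. f (z + Y n) x \<partial>M) - (\<integral>x. f z x \<partial>M)) / Y n" for n
    using z zY[of n] dominated_holomorphic_integrable[OF f] by simp
  ultimately have "(\<lambda>n. ((\<integral>x. f (z + Y n) x \<partial>M) - (\<integral>x. f z x \<partial>M)) / Y n)
      \<longlonglongrightarrow> (\<integral>x. deriv (\<lambda>w. f w x) z \<partial>M)"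
    by (simp only:)
  then show "(\<lambda>n. ((\<integral>x. f (z + X n) x \<partial>M) - (\<integral>x. f z x \<partial>M)) / X n)
      \<longlonglongrightarrow> (\<integral>x. deriv (\<lambda>w. f w x) z \<partial>M)"
    unfolding Y_def by (rule LIMSEQ_offset)
qed

lemma dominated_holomorphic_holomorphic_integral:
  assumes "dominated_holomorphic M S f"
  shows "(\<lambda>z. \<integral>x. f z x \<partial>M) holomorphic_on S"
  using dominated_holomorphic_has_field_derivative_integral[OF assms]
  by (auto simp: holomorphic_on_def field_differentiable_def intro: has_field_derivative_at_within)

lemma dominated_holomorphic_higher_deriv:
  assumes "dominated_holomorphic M S f"
  shows "dominated_holomorphic M S (\<lambda>z x. (deriv ^^ n) (\<lambda>w. f w x) z)"
proof (induction n)
  case (Suc n)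
  then show ?case
    using dominated_holomorphic_deriv[OF Suc] by simp
qed (use assms in simp)

text \<open>The identity of order \<open>n\<close> holds throughout the open set \<open>S\<close>,
  so it may be differentiated once more.\<close>

lemma higher_deriv_integral:
  assumes f: "dominated_holomorphic M S f" and "z \<in> S"
  shows "(deriv ^^ n) (\<lambda>z. \<integral>x. f z x \<partial>M) z = (\<integral>x. (deriv ^^ n) (\<lambda>w. f w x) z \<partial>M)"
  using \<open>z \<in> S\<close>
proof (induction n arbitrary: z)
  case (Suc n)
  have S: "open S" using f by (rule dominated_holomorphic_open)
  have "eventually (\<lambda>w. (deriv ^^ n) (\<lambda>z. \<integral>x. f z x \<partial>M) w =
      (\<integral>x. (deriv ^^ n) (\<lambda>w. f w x) w \<partial>M)) (nhds z)"
    using eventually_nhds_in_open[OF S Suc.prems] by (rule eventually_mono) (rule Suc.IH)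
  then have "deriv ((deriv ^^ n) (\<lambda>z. \<integral>x. f z x \<partial>M)) z =
      deriv (\<lambda>w. \<integral>x. (deriv ^^ n) (\<lambda>w. f w x) w \<partial>M) z"
    by (intro deriv_cong_ev) auto
  also have "\<dots> = (\<integral>x. deriv ((deriv ^^ n) (\<lambda>w. f w x)) z \<partial>M)"
    by (rule DERIV_imp_deriv
        [OF dominated_holomorphic_has_field_derivative_integral
          [OF dominated_holomorphic_higher_deriv[OF f] Suc.prems]])
  finally show ?case by simp
qed simp

subsection \<open>The Macdonald function of imaginary order\<close>

text \<open>The cut-off is part of the integrand, so that the parameter integral runs over the fixed
  measure \<open>lborel\<close>.\<close>

definition macdonald_integrand :: "complex \<Rightarrow> complex \<Rightarrow> real \<Rightarrow> complex" where
  "macdonald_integrand \<nu> z y =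
     indicat_real {0<..} y *\<^sub>R (exp (- z * of_real (cosh y)) * cosh (\<nu> * of_real y))"

section \<open>Elementary estimates for hyperbolic functions\<close>

lemma cosh_sinh_of_real:
  "cosh (complex_of_real y) = of_real (cosh y)" "sinh (complex_of_real y) = of_real (sinh y)"
  by (simp_all add: cosh_field_def sinh_field_def flip: exp_of_real)

text \<open>Both exponentials have modulus 1 when the order is imaginary. This is the source of the
  bounds on the Macdonald function that are uniform in the order.\<close>

lemma norm_cosh_imaginary_le:
  fixes \<nu> :: complex
  assumes "Re \<nu> = 0"
  shows "norm (cosh (\<nu> * of_real y)) \<le> 1" "norm (sinh (\<nu> * of_real y)) \<le> 1"
proof -
  have n: "norm (exp (\<nu> * of_real y)) = 1" "norm (exp (- (\<nu> * of_real y))) = 1"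
    using assms by (simp_all add: norm_exp_eq_Re)
  have "norm (exp (\<nu> * of_real y) + exp (- (\<nu> * of_real y))) \<le> 2"
    using norm_triangle_ineq[of "exp (\<nu> * of_real y)" "exp (- (\<nu> * of_real y))"] n by linarith
  then show "norm (cosh (\<nu> * of_real y)) \<le> 1"
    by (simp add: cosh_field_def norm_divide)
  have "norm (exp (\<nu> * of_real y) - exp (- (\<nu> * of_real y))) \<le> 2"
    using norm_triangle_ineq4[of "exp (\<nu> * of_real y)" "exp (- (\<nu> * of_real y))"] n by linarith
  then show "norm (sinh (\<nu> * of_real y)) \<le> 1"
    by (simp add: sinh_field_def norm_divide)
qed

lemma sinh_ge_self:
  assumes "0 \<le> (x::real)"
  shows "x \<le> sinh x"
proof -
  have "sinh 0 - 0 \<le> sinh x - x"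
    by (rule DERIV_nonneg_imp_nondecreasing[OF assms, where f = "\<lambda>x. sinh x - x"])
       (auto intro!: exI derivative_eq_intros cosh_real_ge_1)
  then show ?thesis by simp
qed

lemma cosh_ge_self: "y \<le> cosh (y::real)"
proof (cases "y \<ge> 0")
  case True
  then show ?thesis
    using sinh_ge_self[of y] sinh_less_cosh_real[of y] by linarith
next
  case False
  then show ?thesis using cosh_real_pos[of y] by linarith
qed

lemma integrable_exp_decay:
  fixes \<epsilon> :: real
  assumes "\<epsilon> > 0"
  shows "integrable lborel (\<lambda>y. indicat_real {0<..} y * exp (- \<epsilon> * y))"
proof -
  have "(\<lambda>y. exp (- \<epsilon> * y)) integrable_on {0..}"
    by (rule integrable_on_exp_minus_to_infinity[OF assms])
  then have "(\<lambda>y. exp (- \<epsilon> * y)) absolutely_integrable_on {0..}"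
    by (intro nonnegative_absolutely_integrable_1) auto
  then have "set_integrable lebesgue {0<..} (\<lambda>y. exp (- \<epsilon> * y))"
    by (rule set_integrable_subset) auto
  then have "integrable lebesgue (\<lambda>y. indicat_real {0<..} y * exp (- \<epsilon> * y))"
    by (simp add: set_integrable_def)
  then show ?thesis
    by (subst (asm) integrable_completion) measurable
qed

text \<open>Since \<open>cosh y\<close> is at least \<open>y\<close>, the exponential factor decays
  at least like \<open>exp (- \<epsilon> * y)\<close>; the majorant is free of \<nu>.\<close>

lemma norm_macdonald_integrand_le:
  assumes "Re \<nu> = 0" "Re z \<ge> \<epsilon>" "\<epsilon> > 0"
  shows "norm (macdonald_integrand \<nu> z y) \<le> indicat_real {0<..} y * exp (- \<epsilon> * y)"
proof -
  have "\<epsilon> * y \<le> \<epsilon> * cosh y"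
    using assms cosh_ge_self by (intro mult_left_mono) auto
  also have "\<dots> \<le> Re z * cosh y"
    using assms cosh_real_nonneg by (intro mult_right_mono) auto
  finally have "norm (exp (- z * of_real (cosh y))) \<le> exp (- \<epsilon> * y)"
    by (simp add: norm_exp_eq_Re)
  then have "norm (exp (- z * of_real (cosh y))) * norm (cosh (\<nu> * of_real y)) \<le> exp (- \<epsilon> * y) * 1"
    using norm_cosh_imaginary_le[OF assms(1)] by (intro mult_mono) auto
  then show ?thesis
    by (auto simp: macdonald_integrand_def norm_mult indicator_def simp del: norm_exp_eq_Re)
qed

text \<open>Joint measurability in the order and the integration variable allows the latter to be
  integrated out with measurability in \<tau> preserved.\<close>

lemma macdonald_integrand_measurable [measurable]:
  "(\<lambda>(\<tau>, y). macdonald_integrand (c * of_real \<tau>) z y) \<in> borel_measurable (borel \<Otimes>\<^sub>M borel)"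
  "macdonald_integrand \<nu> z \<in> borel_measurable borel"
proof -
  have [measurable]: "(\<lambda>x. cosh (x::complex)) \<in> borel_measurable borel" "(\<lambda>x. cosh (x::real)) \<in> borel_measurable borel"
    by (intro borel_measurable_continuous_onI continuous_intros)+
  show "(\<lambda>(\<tau>, y). macdonald_integrand (c * of_real \<tau>) z y) \<in> borel_measurable (borel \<Otimes>\<^sub>M borel)"
    unfolding macdonald_integrand_def by measurable
  have "(\<lambda>y. macdonald_integrand \<nu> z y) \<in> borel_measurable borel"
    unfolding macdonald_integrand_def by measurable
  then show "macdonald_integrand \<nu> z \<in> borel_measurable borel" by simp
qed

lemma macdonald_integrand_has_field_derivative:
  "((\<lambda>z. macdonald_integrand \<nu> z y) has_field_derivative
     - of_real (cosh y) * macdonald_integrand \<nu> z y) (at z)"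
  unfolding macdonald_integrand_def scaleR_conv_of_real
  by (auto intro!: derivative_eq_intros simp: algebra_simps)

lemma deriv_macdonald_integrand:
  "deriv (\<lambda>z. macdonald_integrand \<nu> z y) z = - of_real (cosh y) * macdonald_integrand \<nu> z y"
  "(deriv ^^ 2) (\<lambda>z. macdonald_integrand \<nu> z y) z = of_real (cosh y)^2 * macdonald_integrand \<nu> z y"
proof -
  have *: "deriv (\<lambda>z. macdonald_integrand \<nu> z y) = (\<lambda>z. - of_real (cosh y) * macdonald_integrand \<nu> z y)"
    by (rule ext, rule DERIV_imp_deriv[OF macdonald_integrand_has_field_derivative])
  then show "deriv (\<lambda>z. macdonald_integrand \<nu> z y) z = - of_real (cosh y) * macdonald_integrand \<nu> z y"
    by (rule fun_cong)
  have "deriv (\<lambda>z. - of_real (cosh y) * macdonald_integrand \<nu> z y) z =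
      - of_real (cosh y) * (- of_real (cosh y) * macdonald_integrand \<nu> z y)"
    by (rule DERIV_imp_deriv[OF DERIV_cmult[OF macdonald_integrand_has_field_derivative]])
  then show "(deriv ^^ 2) (\<lambda>z. macdonald_integrand \<nu> z y) z = of_real (cosh y)^2 * macdonald_integrand \<nu> z y"
    unfolding numeral_2_eq_2 funpow.simps o_apply id_apply *
    by (simp only: power2_eq_square numeral_2_eq_2[symmetric]) simp
qed

text \<open>On the ball of radius \<open>Re z / 2\<close> the real parts stay above
  \<open>Re z / 2\<close>, so one exponential dominates the integrand for all points of the
  ball.\<close>

lemma dominated_holomorphic_macdonald:
  assumes "Re \<nu> = 0"
  shows "dominated_holomorphic lborel {z. Re z > 0} (macdonald_integrand \<nu>)"
  unfolding dominated_holomorphic_def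
proof (intro conjI ballI)
  show "open {z. 0 < Re z}" by (rule open_halfspace_Re_gt)
  show "(\<lambda>z. macdonald_integrand \<nu> z y) holomorphic_on {z. 0 < Re z}" for y
    unfolding holomorphic_on_def field_differentiable_def
    by (intro ballI exI) (rule has_field_derivative_at_within[OF macdonald_integrand_has_field_derivative])
  fix z :: complex assume "z \<in> {z. 0 < Re z}"
  then have z: "Re z > 0" by simp
  show "macdonald_integrand \<nu> z \<in> borel_measurable lborel" by measurable
  have w: "Re w \<ge> Re z / 2" if "w \<in> ball z (Re z / 2)" for w
    using that abs_Re_le_cmod[of "z - w"] by (simp add: dist_norm)
  show "\<exists>e>0. \<exists>h. integrable lborel h \<and> ball z e \<subseteq> {z. 0 < Re z} \<and>
      (\<forall>w\<in>ball z e. \<forall>y\<in>space lborel. norm (macdonald_integrand \<nu> w y) \<le> h y)"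
  proof (intro exI conjI ballI)
    show "integrable lborel (\<lambda>y. indicat_real {0<..} y * exp (- (Re z / 2) * y))"
      using z by (intro integrable_exp_decay) simp
    show "ball z (Re z / 2) \<subseteq> {z. 0 < Re z}"
      using w z by fastforce
    show "norm (macdonald_integrand \<nu> w y) \<le> indicat_real {0<..} y * exp (- (Re z / 2) * y)"
      if "w \<in> ball z (Re z / 2)" for w y
      using w[OF that] z assms by (intro norm_macdonald_integrand_le) auto
  qed (use z in simp)
qed

text \<open>Trades the gauge integral of the definition for a Bochner integral, to which the results
  on parameter integrals apply.\<close>

lemma bessel_K_eq_lborel_integral:
  assumes "Re \<nu> = 0" "Re z > 0"
  shows "bessel_K \<nu> z = (\<integral>y. macdonald_integrand \<nu> z y \<partial>lborel)"
proof -
  have "integrable lborel (macdonald_integrand \<nu> z)"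
    by (rule dominated_holomorphic_integrable[OF dominated_holomorphic_macdonald]) (use assms in auto)
  then have "set_integrable lborel {0<..} (\<lambda>y. exp (- z * of_real (cosh y)) * cosh (\<nu> * of_real y))"
    by (simp add: set_integrable_def macdonald_integrand_def[abs_def])
  from set_borel_integral_eq_integral(2)[OF this] show ?thesis
    by (simp add: bessel_K_def set_lebesgue_integral_def macdonald_integrand_def[abs_def])
qed

lemma norm_bessel_K_le:
  assumes "Re \<nu> = 0" "Re z \<ge> \<epsilon>" "\<epsilon> > 0"
  shows "norm (bessel_K \<nu> z) \<le> (\<integral>y. indicat_real {0<..} y * exp (- \<epsilon> * y) \<partial>lborel)"
proof -
  have "norm (\<integral>y. macdonald_integrand \<nu> z y \<partial>lborel) \<le> (\<integral>y. norm (macdonald_integrand \<nu> z y) \<partial>lborel)"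
    by (rule integral_norm_bound)
  also have "\<dots> \<le> (\<integral>y. indicat_real {0<..} y * exp (- \<epsilon> * y) \<partial>lborel)"
  proof (rule integral_mono)
    have "integrable lborel (macdonald_integrand \<nu> z)"
      by (rule dominated_holomorphic_integrable[OF dominated_holomorphic_macdonald]) (use assms in auto)
    then show "integrable lborel (\<lambda>y. norm (macdonald_integrand \<nu> z y))"
      by (rule integrable_norm)
  qed (use assms integrable_exp_decay norm_macdonald_integrand_le in auto)
  finally show ?thesis
    using assms by (simp add: bessel_K_eq_lborel_integral)
qed

lemma bessel_K_order_measurable:
  assumes "Re c = 0" "Re z > 0"
  shows "(\<lambda>\<tau>. bessel_K (c * of_real \<tau>) z) \<in> borel_measurable borel"
proof -
  have "(\<lambda>\<tau>::real. \<integral>y. macdonald_integrand (c * of_real \<tau>) z y \<partial>lborel) \<in> borel_measurable borel"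
    by (rule lborel.borel_measurable_lebesgue_integral) measurable
  then show ?thesis
    using assms by (subst bessel_K_eq_lborel_integral) auto
qed

text \<open>Differentiation under the integral sign inserts the factors \<open>- cosh y\<close> and
  \<open>cosh y ^ 2\<close>. Bessel's equation then says that a certain integral vanishes, because
  its integrand is an exact derivative with zero boundary values.\<close>

lemma bessel_K_has_field_derivative:
  assumes "Re \<nu> = 0" "Re z > 0"
  shows "(bessel_K \<nu> has_field_derivative deriv (bessel_K \<nu>) z) (at z)"
    and "(deriv (bessel_K \<nu>) has_field_derivative deriv (deriv (bessel_K \<nu>)) z) (at z)"
    and "z^2 * deriv (deriv (bessel_K \<nu>)) z + z * deriv (bessel_K \<nu>) z = (z^2 + \<nu>^2) * bessel_K \<nu> z"
proof -
  let ?S = "{z. Re z > 0}"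
  let ?m = "macdonald_integrand \<nu>"
  let ?K = "\<lambda>z. \<integral>y. ?m z y \<partial>lborel"
  have S: "open ?S" by (rule open_halfspace_Re_gt)
  have z: "z \<in> ?S" using assms by simp
  note dom = dominated_holomorphic_macdonald[OF assms(1)]
  have hol: "bessel_K \<nu> holomorphic_on ?S"
    using dominated_holomorphic_holomorphic_integral[OF dom]
    by (rule holomorphic_transform) (use assms bessel_K_eq_lborel_integral in auto)
  show "(bessel_K \<nu> has_field_derivative deriv (bessel_K \<nu>) z) (at z)"
    using hol S z by (rule holomorphic_derivI)
  show "(deriv (bessel_K \<nu>) has_field_derivative deriv (deriv (bessel_K \<nu>)) z) (at z)"
    using holomorphic_deriv[OF hol S] S z by (rule holomorphic_derivI)
  have "(deriv ^^ k) (bessel_K \<nu>) z = (deriv ^^ k) ?K z" for k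
    using assms(1) S z bessel_K_eq_lborel_integral
    by (intro higher_deriv_cong_ev eventually_mono[OF eventually_nhds_in_open[OF S z]]) auto
  then have D: "(deriv ^^ k) (bessel_K \<nu>) z = (\<integral>y. (deriv ^^ k) (\<lambda>w. ?m w y) z \<partial>lborel)" for k
    using higher_deriv_integral[OF dom z] by simp
  have I: "integrable lborel (\<lambda>y. (deriv ^^ k) (\<lambda>w. ?m w y) z)" for k
    by (rule dominated_holomorphic_integrable[OF dominated_holomorphic_higher_deriv[OF dom] z])
  have K0: "bessel_K \<nu> z = (\<integral>y. ?m z y \<partial>lborel)"
    using D[of 0] by simp
  have K1: "deriv (bessel_K \<nu>) z = (\<integral>y. - of_real (cosh y) * ?m z y \<partial>lborel)"
    using D[of 1] unfolding One_nat_def funpow.simps o_apply id_apply deriv_macdonald_integrand .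
  have "deriv (deriv (bessel_K \<nu>)) z = (deriv ^^ 2) (bessel_K \<nu>) z"
    by (simp add: numeral_2_eq_2)
  then have K2: "deriv (deriv (bessel_K \<nu>)) z = (\<integral>y. of_real (cosh y)^2 * ?m z y \<partial>lborel)"
    using D[of 2] unfolding deriv_macdonald_integrand by simp
  have I0: "integrable lborel (\<lambda>y. ?m z y)"
    and I1: "integrable lborel (\<lambda>y. - of_real (cosh y) * ?m z y)"
    and I2: "integrable lborel (\<lambda>y. of_real (cosh y)^2 * ?m z y)"
    using I[of 0] I[of 1] I[of 2] deriv_macdonald_integrand by simp_all
  \<comment> \<open>With \<open>E y = exp (- z cosh y)\<close>, Bessel's operator applied under the integral sign gives
    \<open>(E'' - \<nu>\<^sup>2 E) cosh (\<nu> y) = (E' cosh (\<nu> y) - \<nu> E sinh (\<nu> y))'\<close>, and the bracket is \<open>F\<close>.\<close>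
  define F where "F y = - (exp (- z * of_real (cosh y)) *
      (z * of_real (sinh y) * cosh (\<nu> * of_real y) + \<nu> * sinh (\<nu> * of_real y)))" for y :: real
  define f where "f y = exp (- z * of_real (cosh y)) * cosh (\<nu> * of_real y) *
      (z^2 * of_real (cosh y)^2 - z * of_real (cosh y) - (z^2 + \<nu>^2))" for y :: real
  \<comment> \<open>The integral of this combination is the difference of the two sides of Bessel's
    equation.\<close>
  have f_eq: "indicat_real {0<..} y *\<^sub>R f y =
      z^2 * (of_real (cosh y)^2 * ?m z y) + z * (- of_real (cosh y) * ?m z y) - (z^2 + \<nu>^2) * ?m z y" for y
    by (simp add: f_def macdonald_integrand_def indicator_def algebra_simps)
  have "(LBINT y=0..\<infinity>. f y) = 0 - 0"
  proof (rule interval_integral_FTC_integrable)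
    show "set_integrable lborel (einterval 0 \<infinity>) f"
      unfolding set_integrable_def using I0 I1 I2
      by (simp add: f_eq einterval_def zero_ereal_def greaterThan_def[symmetric] del: mult_minus_left)
    show "(F has_vector_derivative f y) (at y)" for y
    proof -
      \<comment> \<open>The second derivative of \<open>exp (- z cosh y)\<close> brings in
        \<open>z^2 sinh^2\<close>; this identity trades it for the \<open>cosh^2\<close> and the
        constant \<open>- z^2\<close> in \<open>f\<close>.\<close>
      have s: "sinh (complex_of_real y) ^ 2 = cosh (complex_of_real y)^2 - 1"
        by (simp add: cosh_square_eq)
      have "((\<lambda>y. - (exp (- z * cosh y) * (z * sinh y * cosh (\<nu> * y) + \<nu> * sinh (\<nu> * y))))
          has_field_derivative
          exp (- z * cosh y) * cosh (\<nu> * y) * (z^2 * sinh y^2 - z * cosh y - \<nu>^2)) (at y)" for y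
        by (auto intro!: derivative_eq_intros simp: algebra_simps power2_eq_square)
      from has_vector_derivative_real_field[OF this[of "of_real y"]] show ?thesis
        unfolding F_def[abs_def] f_def s cosh_sinh_of_real[symmetric]
        by (rule has_vector_derivative_eq_rhs) (simp add: algebra_simps)
    qed
    show "isCont f y" for y
      unfolding f_def[abs_def] by (intro continuous_intros)
    have "isCont F 0"
      unfolding F_def[abs_def] by (intro continuous_intros)
    then have "(F \<longlongrightarrow> 0) (at_right 0)"
      by (simp add: isCont_def F_def filterlim_at_within_If tendsto_within_subset[of F _ 0 UNIV])
    then show "((F \<circ> real_of_ereal) \<longlongrightarrow> 0) (at_right 0)"
      by (simp add: zero_ereal_def ereal_tendsto_simps)
    \<comment> \<open>The limit is taken in the variable \<open>c = cosh y\<close>, in which the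
      majorant of \<open>F\<close> is a decaying exponential times a linear polynomial.\<close>
    have lim: "((\<lambda>c. exp (- Re z * c) * (norm z * c + norm \<nu>)) \<longlongrightarrow> 0) at_top"
      using assms(2) by real_asymp
    have "((\<lambda>y. exp (- Re z * cosh y) * (norm z * cosh y + norm \<nu>)) \<longlongrightarrow> 0) at_top"
      by (rule filterlim_compose[OF lim cosh_real_at_top])
    moreover have "norm (F y) \<le> exp (- Re z * cosh y) * (norm z * cosh y + norm \<nu>)" for y
    proof -
      have "\<bar>sinh y\<bar> \<le> cosh y"
        using sinh_less_cosh_real[of y] sinh_less_cosh_real[of "-y"] by simp
      then have "norm (z * of_real (sinh y) * cosh (\<nu> * of_real y)) \<le> norm z * cosh y * 1"
        using norm_cosh_imaginary_le[OF assms(1), of y] unfolding norm_mult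
        by (intro mult_mono) auto
      moreover have "norm (\<nu> * sinh (\<nu> * of_real y)) \<le> norm \<nu> * 1"
        using norm_cosh_imaginary_le[OF assms(1), of y] unfolding norm_mult
        by (intro mult_mono) auto
      ultimately have "norm (z * of_real (sinh y) * cosh (\<nu> * of_real y) + \<nu> * sinh (\<nu> * of_real y))
          \<le> norm z * cosh y + norm \<nu>"
        by (intro norm_triangle_le) linarith
      then show ?thesis
        unfolding F_def norm_minus_cancel norm_mult by (intro mult_mono) (auto simp: norm_exp_eq_Re)
    qed
    ultimately have "(F \<longlongrightarrow> 0) at_top"
      by (intro Lim_null_comparison[of F]) auto
    then show "((F \<circ> real_of_ereal) \<longlongrightarrow> 0) (at_left \<infinity>)"
      by (simp add: ereal_tendsto_simps)
  qed simp
  then have "(\<integral>y. indicat_real {0<..} y *\<^sub>R f y \<partial>lborel) = 0"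
    by (simp add: interval_lebesgue_integral_def set_lebesgue_integral_def einterval_def
        zero_ereal_def greaterThan_def[symmetric])
  then show "z^2 * deriv (deriv (bessel_K \<nu>)) z + z * deriv (bessel_K \<nu>) z = (z^2 + \<nu>^2) * bessel_K \<nu> z"
    unfolding f_eq using I0 I1 I2 by (simp add: K0 K1 K2 del: mult_minus_left)
qed

subsection \<open>The kernel in the cut plane\<close>

lemma higher_deriv_Suc_on_open:
  assumes "open S" "\<And>z. z \<in> S \<Longrightarrow> (deriv ^^ n) f z = h z"
    and "\<And>z. z \<in> S \<Longrightarrow> (h has_field_derivative h' z) (at z)" and "z \<in> S"
  shows "(deriv ^^ Suc n) f z = h' z"
proof -
  have "eventually (\<lambda>w. (deriv ^^ n) f w = h w) (nhds z)"
    using eventually_nhds_in_open[OF assms(1,4)] by (rule eventually_mono) (rule assms(2))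
  then have "deriv ((deriv ^^ n) f) z = deriv h z"
    by (intro deriv_cong_ev) auto
  with DERIV_imp_deriv[OF assms(3)[OF assms(4)]] show ?thesis by simp
qed

text \<open>
  Here \<open>f\<^sub>i\<close> is the result of applying the Euler operator \<open>z d/dz\<close> to \<open>f0\<close> \<open>i\<close> times; the
  coefficients are signed Stirling numbers of the first kind.
\<close>

lemma higher_deriv_of_euler_operator:
  assumes S: "open S" "0 \<notin> S"
    and d: "\<And>z. z \<in> S \<Longrightarrow> (f0 has_field_derivative f1 z / z) (at z)"
      "\<And>z. z \<in> S \<Longrightarrow> (f1 has_field_derivative f2 z / z) (at z)"
      "\<And>z. z \<in> S \<Longrightarrow> (f2 has_field_derivative f3 z / z) (at z)"
      "\<And>z. z \<in> S \<Longrightarrow> (f3 has_field_derivative f4 z / z) (at z)"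
    and z: "z \<in> S"
  shows "(deriv ^^ 1) f0 z = f1 z / z"
    and "(deriv ^^ 2) f0 z = (f2 z - f1 z) / z ^ 2"
    and "(deriv ^^ 3) f0 z = (f3 z - 3 * f2 z + 2 * f1 z) / z ^ 3"
    and "(deriv ^^ 4) f0 z = (f4 z - 6 * f3 z + 11 * f2 z - 6 * f1 z) / z ^ 4"
proof -
  have nz: "z \<noteq> 0" if "z \<in> S" for z using that S by auto
  have 1: "(deriv ^^ Suc 0) f0 z = f1 z / z" if "z \<in> S" for z
    by (rule higher_deriv_Suc_on_open[OF S(1) _ d(1) that]) simp
  have d1: "((\<lambda>z. f1 z / z) has_field_derivative (f2 z - f1 z) / z ^ 2) (at z)" if "z \<in> S" for z
    using nz[OF that]
    by (auto intro!: derivative_eq_intros d[OF that] simp: field_simps power2_eq_square)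
  have 2: "(deriv ^^ Suc (Suc 0)) f0 z = (f2 z - f1 z) / z ^ 2" if "z \<in> S" for z
    by (rule higher_deriv_Suc_on_open[OF S(1) 1 d1 that])
  have d2: "((\<lambda>z. (f2 z - f1 z) / z ^ 2) has_field_derivative (f3 z - 3 * f2 z + 2 * f1 z) / z ^ 3) (at z)"
    if "z \<in> S" for z
    using nz[OF that]
    by (auto intro!: derivative_eq_intros d[OF that] simp: field_simps eval_nat_numeral)
  have 3: "(deriv ^^ Suc (Suc (Suc 0))) f0 z = (f3 z - 3 * f2 z + 2 * f1 z) / z ^ 3" if "z \<in> S" for z
    by (rule higher_deriv_Suc_on_open[OF S(1) 2 d2 that])
  have d3: "((\<lambda>z. (f3 z - 3 * f2 z + 2 * f1 z) / z ^ 3) has_field_derivative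
      (f4 z - 6 * f3 z + 11 * f2 z - 6 * f1 z) / z ^ 4) (at z)" if "z \<in> S" for z
    using nz[OF that]
    by (auto intro!: derivative_eq_intros d[OF that] simp: field_simps eval_nat_numeral)
  have 4: "(deriv ^^ Suc (Suc (Suc (Suc 0)))) f0 z =
      (f4 z - 6 * f3 z + 11 * f2 z - 6 * f1 z) / z ^ 4" if "z \<in> S" for z
    by (rule higher_deriv_Suc_on_open[OF S(1) 3 d3 that])
  have n: "(1::nat) = Suc 0" "(2::nat) = Suc (Suc 0)" "(3::nat) = Suc (Suc (Suc 0))"
    "(4::nat) = Suc (Suc (Suc (Suc 0)))"
    by simp_all
  show "(deriv ^^ 1) f0 z = f1 z / z" unfolding n(1) by (rule 1[OF z])
  show "(deriv ^^ 2) f0 z = (f2 z - f1 z) / z ^ 2"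
    using 2[OF z] by (simp only: n(2)[symmetric])
  show "(deriv ^^ 3) f0 z = (f3 z - 3 * f2 z + 2 * f1 z) / z ^ 3"
    using 3[OF z] by (simp only: n(3)[symmetric])
  show "(deriv ^^ 4) f0 z = (f4 z - 6 * f3 z + 11 * f2 z - 6 * f1 z) / z ^ 4"
    using 4[OF z] by (simp only: n(4)[symmetric])
qed

text \<open>The holomorphic continuation of \<open>2 (4r)^(1/4)\<close>. Nested principal square
  roots make both the location of its values and its derivative consequences of facts about
  \<open>csqrt\<close>.\<close>

definition kelvin_arg :: "complex \<Rightarrow> complex" where
  "kelvin_arg \<rho> = 2 * csqrt (csqrt (4 * \<rho>))"

text \<open>
  The cut plane is the natural domain: there the fourth root has argument in
  \<open>(-\<pi>/4, \<pi>/4)\<close>, so both Macdonald functions are evaluated in the right half-plane.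
\<close>

definition kernel_ext :: "real \<Rightarrow> complex \<Rightarrow> complex" where
  "kernel_ext \<tau> \<rho> =
     bessel_K (2 * \<i> * of_real \<tau>) (kelvin_arg \<rho> * cis (pi / 4)) *
     bessel_K (2 * \<i> * of_real \<tau>) (kelvin_arg \<rho> * cis (- pi / 4))"

section \<open>Principal roots on the cut plane\<close>

lemma open_slit_plane: "open (- \<real>\<^sub>\<le>\<^sub>0 :: complex set)"
  by (simp add: open_Compl)

text \<open>The square of the real part of the root is half of \<open>cmod z + Re z\<close>, which
  vanishes only on the nonpositive reals.\<close>

lemma csqrt_Re_pos:
  assumes "z \<notin> \<real>\<^sub>\<le>\<^sub>0"
  shows "Re (csqrt z) > 0"
proof -
  have "cmod z + Re z \<noteq> 0"
  proof
    assume *: "cmod z + Re z = 0"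
    then have "(cmod z)^2 = (Re z)^2"
      by (simp add: eq_neg_iff_add_eq_0[symmetric])
    then have "Im z = 0" by (simp add: cmod_power2)
    moreover have "Re z \<le> 0" using * norm_ge_zero[of z] by linarith
    ultimately show False
      using assms by (simp add: complex_nonpos_Reals_iff)
  qed
  then have "cmod z + Re z > 0"
    using abs_Re_le_cmod[of z] by linarith
  then show ?thesis by simp
qed

lemma four_times_slit: "4 * \<rho> \<notin> \<real>\<^sub>\<le>\<^sub>0" if "\<rho> \<notin> \<real>\<^sub>\<le>\<^sub>0" for \<rho> :: complex
  using that by (auto simp: complex_nonpos_Reals_iff)

text \<open>The square of the fourth root \<open>w\<close> has positive real part, so
  \<open>w\<close> lies in the open sector \<open>\<bar>Im w\<bar> < Re w\<close>; rotation by an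
  eighth of a turn either way stays in the right half-plane.\<close>

lemma kelvin_arg_cis_Re_pos:
  assumes "\<rho> \<notin> \<real>\<^sub>\<le>\<^sub>0"
  shows "Re (kelvin_arg \<rho> * cis (pi / 4)) > 0" "Re (kelvin_arg \<rho> * cis (- pi / 4)) > 0"
proof -
  define w where "w = csqrt (csqrt (4 * \<rho>))"
  have q: "Re (csqrt (4 * \<rho>)) > 0"
    using csqrt_Re_pos four_times_slit assms by blast
  then have w: "Re w > 0"
    unfolding w_def by (intro csqrt_Re_pos) (auto simp: complex_nonpos_Reals_iff)
  have "w^2 = csqrt (4 * \<rho>)"
    by (simp add: w_def)
  with q have "(Im w)^2 < (Re w)^2"
    by (metis Re_power2 diff_gt_0_iff_gt)
  with w have "\<bar>Im w\<bar> < Re w"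
    by (intro power2_less_imp_less[of "\<bar>Im w\<bar>" "Re w"]) auto
  then have "0 < (Re w + Im w) * sqrt 2" "0 < (Re w - Im w) * sqrt 2"
    by (simp_all add: abs_less_iff)
  then show "Re (kelvin_arg \<rho> * cis (pi / 4)) > 0" "Re (kelvin_arg \<rho> * cis (- pi / 4)) > 0"
    unfolding kelvin_arg_def w_def[symmetric] by (simp_all add: cos_45 sin_45 algebra_simps)
qed

text \<open>The sum of squares factors as \<open>(ker + i kei) (ker - i kei)\<close>, and the
  exponential prefactors of the two Macdonald functions are reciprocal.\<close>

lemma kernel_K_eq_kernel_ext:
  assumes "r > 0"
  shows "kernel_K \<tau> r = kernel_ext \<tau> (of_real r)"
proof -
  let ?\<nu> = "2 * \<i> * complex_of_real \<tau>"
  let ?x = "2 * (4 * r) powr (1 / 4)"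
  have "(4 * r) powr (1 / 4) = sqrt (sqrt (4 * r))"
    using assms by (simp add: powr_half_sqrt[symmetric] powr_powr)
  then have x: "complex_of_real ?x = kelvin_arg (of_real r)"
    using assms of_real_sqrt[of "4 * r"] of_real_sqrt[of "sqrt (4 * r)"] by (simp add: kelvin_arg_def)
  have "kernel_K \<tau> r = (kelvin_ker ?\<nu> ?x + \<i> * kelvin_kei ?\<nu> ?x) * (kelvin_ker ?\<nu> ?x - \<i> * kelvin_kei ?\<nu> ?x)"
    unfolding kernel_K_def by (simp add: algebra_simps power2_eq_square)
  also have "\<dots> = (exp (- (?\<nu> * of_real pi * \<i> / 2)) * exp (?\<nu> * of_real pi * \<i> / 2)) * kernel_ext \<tau> (of_real r)"
    unfolding ker_kei_pair kernel_ext_def x by (simp only: mult_ac)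
  also have "\<dots> = kernel_ext \<tau> (of_real r)"
    by (simp flip: exp_add)
  finally show ?thesis .
qed

section \<open>The Euler operator applied to the kernel\<close>

lemma csqrt_four_times_has_field_derivative:
  assumes "\<rho> \<notin> \<real>\<^sub>\<le>\<^sub>0"
  shows "((\<lambda>\<rho>. csqrt (4 * \<rho>)) has_field_derivative csqrt (4 * \<rho>) / 2 / \<rho>) (at \<rho>)"
proof -
  have "\<rho> \<noteq> 0" using assms by auto
  moreover have "4 * \<rho> = csqrt (4 * \<rho>) * csqrt (4 * \<rho>)"
    using power2_csqrt[of "4 * \<rho>"] by (simp add: power2_eq_square)
  ultimately show ?thesis
    using four_times_slit[OF assms]
    by (auto intro!: derivative_eq_intros simp: field_simps)
qed

text \<open>The final division by \<open>\<rho>\<close> displays \<open>kelvin_arg\<close> as an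
  eigenfunction of the Euler operator with eigenvalue 1/4; for \<open>csqrt (4 * \<rho>)\<close> the
  eigenvalue is 1/2.\<close>

lemma kelvin_arg_has_field_derivative:
  assumes "\<rho> \<notin> \<real>\<^sub>\<le>\<^sub>0"
  shows "(kelvin_arg has_field_derivative kelvin_arg \<rho> / 4 / \<rho>) (at \<rho>)"
proof -
  define q where "q = csqrt (4 * \<rho>)"
  have q: "Re q > 0"
    using csqrt_Re_pos four_times_slit assms unfolding q_def by blast
  have nz: "\<rho> \<noteq> 0" "csqrt q \<noteq> 0" using assms q by auto
  have qq: "q = csqrt q * csqrt q"
    using power2_csqrt[of q] by (simp add: power2_eq_square)
  have "q \<notin> \<real>\<^sub>\<le>\<^sub>0" using q by (auto simp: complex_nonpos_Reals_iff)
  then have "(kelvin_arg has_field_derivative 2 * (q / 2 / \<rho> / (2 * csqrt q))) (at \<rho>)"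
    unfolding kelvin_arg_def[abs_def] q_def
    by (intro DERIV_cmult has_field_derivative_csqrt' csqrt_four_times_has_field_derivative assms)
  moreover have "2 * (q / 2 / \<rho> / (2 * csqrt q)) = kelvin_arg \<rho> / 4 / \<rho>"
  proof -
    have "2 * ((r * r) / 2 / \<rho> / (2 * r)) = 2 * r / 4 / \<rho>" if "r \<noteq> 0" for r
      using that nz(1) by (simp add: field_simps)
    from this[OF nz(2)] show ?thesis
      unfolding qq[symmetric] by (simp only: kelvin_arg_def q_def)
  qed
  ultimately show ?thesis by simp
qed

text \<open>With \<open>x = kelvin_arg \<rho> * c\<close>, the operator
  \<open>\<rho> d/d\<rho>\<close> acts as a quarter of \<open>x d/dx\<close>. Bessel's equation
  therefore yields the coefficient \<open>(x^2 + \<nu>^2) / 16\<close>, where \<open>x^2\<close> is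
  a multiple of \<open>csqrt (4 * \<rho>)\<close>.\<close>

lemma bessel_K_kelvin_arg_euler:
  fixes c :: complex
  assumes \<rho>: "\<rho> \<notin> \<real>\<^sub>\<le>\<^sub>0" and c: "Re (kelvin_arg \<rho> * c) > 0" and \<nu>: "Re \<nu> = 0"
  defines "P \<equiv> \<lambda>\<rho>. bessel_K \<nu> (kelvin_arg \<rho> * c)"
    and "P1 \<equiv> \<lambda>\<rho>. kelvin_arg \<rho> * c / 4 * deriv (bessel_K \<nu>) (kelvin_arg \<rho> * c)"
  shows "(P has_field_derivative P1 \<rho> / \<rho>) (at \<rho>)"
    and "(P1 has_field_derivative (c^2 * csqrt (4 * \<rho>) / 4 + \<nu>^2 / 16) * P \<rho> / \<rho>) (at \<rho>)"
proof -
  define x where "x = kelvin_arg \<rho> * c"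
  have nz: "\<rho> \<noteq> 0" using \<rho> by auto
  have dx: "((\<lambda>\<rho>. kelvin_arg \<rho> * c) has_field_derivative x / 4 / \<rho>) (at \<rho>)"
    unfolding x_def
    by (auto intro!: derivative_eq_intros kelvin_arg_has_field_derivative[OF \<rho>] simp: nz field_simps)
  note K = bessel_K_has_field_derivative[OF \<nu> c[folded x_def]]
  have dP: "(P has_field_derivative deriv (bessel_K \<nu>) x * (x / 4 / \<rho>)) (at \<rho>)"
    unfolding P_def using K(1) dx unfolding x_def by (rule DERIV_chain2)
  then show "(P has_field_derivative P1 \<rho> / \<rho>) (at \<rho>)"
    by (simp add: P1_def x_def field_simps)
  have d: "((\<lambda>\<rho>. deriv (bessel_K \<nu>) (kelvin_arg \<rho> * c)) has_field_derivative
      deriv (deriv (bessel_K \<nu>)) x * (x / 4 / \<rho>)) (at \<rho>)"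
    using K(2) dx unfolding x_def by (rule DERIV_chain2)
  have "(P1 has_field_derivative (x / 4 / \<rho> / 4) * deriv (bessel_K \<nu>) x +
      deriv (deriv (bessel_K \<nu>)) x * (x / 4 / \<rho>) * (x / 4)) (at \<rho>)"
    unfolding P1_def using DERIV_mult[OF DERIV_cdivide[OF dx, of 4] d] by (simp add: x_def)
  moreover have "(x / 4 / \<rho> / 4) * deriv (bessel_K \<nu>) x + deriv (deriv (bessel_K \<nu>)) x * (x / 4 / \<rho>) * (x / 4) =
      (x^2 * deriv (deriv (bessel_K \<nu>)) x + x * deriv (bessel_K \<nu>) x) / 16 / \<rho>"
    using nz by (simp add: field_simps power2_eq_square)
  moreover have "x^2 = c^2 * (4 * csqrt (4 * \<rho>))"
    by (simp add: x_def kelvin_arg_def power_mult_distrib)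
  then have "(x^2 + \<nu>^2) * bessel_K \<nu> x / 16 / \<rho> = (c^2 * csqrt (4 * \<rho>) / 4 + \<nu>^2 / 16) * P \<rho> / \<rho>"
    unfolding P_def x_def[symmetric] using nz by (simp add: field_simps)
  ultimately show "(P1 has_field_derivative (c^2 * csqrt (4 * \<rho>) / 4 + \<nu>^2 / 16) * P \<rho> / \<rho>) (at \<rho>)"
    unfolding K(3) by (simp only:)
qed

lemma cis_quarter_squared: "cis (pi / 4) ^ 2 = \<i>" "cis (- pi / 4) ^ 2 = - \<i>"
  by (simp_all add: Complex.DeMoivre)

lemma kernel_ext_holomorphic: "kernel_ext \<tau> holomorphic_on - \<real>\<^sub>\<le>\<^sub>0"
proof -
  have "(kernel_ext \<tau>) field_differentiable (at \<rho>)" if "\<rho> \<notin> \<real>\<^sub>\<le>\<^sub>0" for \<rho>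
    unfolding kernel_ext_def[abs_def]
    using bessel_K_kelvin_arg_euler(1)[OF that kelvin_arg_cis_Re_pos(1)[OF that], of "2 * \<i> * of_real \<tau>"]
      bessel_K_kelvin_arg_euler(1)[OF that kelvin_arg_cis_Re_pos(2)[OF that], of "2 * \<i> * of_real \<tau>"]
    by (intro field_differentiable_mult) (auto simp: field_differentiable_def)
  then show ?thesis
    by (auto simp: holomorphic_on_def intro: field_differentiable_at_within)
qed

text \<open>This is the partial differential equation with the second \<theta>-derivative replaced
  by multiplication by \<open>\<tau>^2\<close>. Its coefficients arise from expanding the powers of
  the Euler operator and dividing by \<open>\<rho>\<close>.\<close>

lemma kernel_ext_ode:
  fixes \<tau> :: real
  assumes \<rho>: "\<rho> \<notin> \<real>\<^sub>\<le>\<^sub>0"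
  defines "d \<equiv> \<lambda>k. (deriv ^^ k) (kernel_ext \<tau>) \<rho>"
  shows "\<rho> ^ 3 * d 4 + of_real (\<tau>^2) * (\<rho> * d 2 + 1 / 2 * d 1)
    + 11 / 2 * \<rho> ^ 2 * d 3 + 11 / 2 * \<rho> * d 2 + 1 / 2 * d 1 - d 0 = 0"
proof -
  let ?\<nu> = "2 * \<i> * complex_of_real \<tau>"
  define q where "q \<rho> = csqrt (4 * \<rho>)" for \<rho>
  define P where "P \<rho> = bessel_K ?\<nu> (kelvin_arg \<rho> * cis (pi / 4))" for \<rho>
  define P1 where "P1 \<rho> = kelvin_arg \<rho> * cis (pi / 4) / 4 * deriv (bessel_K ?\<nu>) (kelvin_arg \<rho> * cis (pi / 4))" for \<rho>
  define Q where "Q \<rho> = bessel_K ?\<nu> (kelvin_arg \<rho> * cis (- pi / 4))" for \<rho>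
  define Q1 where "Q1 \<rho> = kelvin_arg \<rho> * cis (- pi / 4) / 4 * deriv (bessel_K ?\<nu>) (kelvin_arg \<rho> * cis (- pi / 4))" for \<rho>
  define t where "t = complex_of_real (\<tau>^2)"
  have \<nu>2: "?\<nu>^2 / 16 = - t / 4"
    by (simp add: t_def power_mult_distrib)
  have D: "(P has_field_derivative P1 z / z) (at z)"
    "(P1 has_field_derivative (\<i> * q z / 4 - t / 4) * P z / z) (at z)"
    "(Q has_field_derivative Q1 z / z) (at z)"
    "(Q1 has_field_derivative (- \<i> * q z / 4 - t / 4) * Q z / z) (at z)"
    "(q has_field_derivative q z / 2 / z) (at z)"
    if z: "z \<notin> \<real>\<^sub>\<le>\<^sub>0" for z
    using bessel_K_kelvin_arg_euler[OF z kelvin_arg_cis_Re_pos(1)[OF z], of ?\<nu>]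
      bessel_K_kelvin_arg_euler[OF z kelvin_arg_cis_Re_pos(2)[OF z], of ?\<nu>]
      csqrt_four_times_has_field_derivative[OF z]
    unfolding cis_quarter_squared \<nu>2 P_def[abs_def] P1_def[abs_def] Q_def[abs_def] Q1_def[abs_def] q_def[abs_def]
    by simp_all
  \<comment> \<open>\<open>D = z d/dz\<close> satisfies \<open>D P = P1\<close>, \<open>D Q = Q1\<close>, \<open>D W = - i q P Q / 2\<close>, so the functions below
    arise from \<open>f0 = P Q\<close> by repeated application of \<open>D\<close>; eliminating \<open>W\<close> gives
    \<open>(D - 1/2) D (D\<^sup>2 + \<tau>\<^sup>2) f0 = z f0\<close>.\<close>
  define W where "W z = P z * Q1 z - P1 z * Q z" for z
  define f0 where "f0 z = P z * Q z" for z
  define f1 where "f1 z = P1 z * Q z + P z * Q1 z" for z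
  \<comment> \<open>The terms \<open>\<i> q / 4\<close> and \<open>- \<i> q / 4\<close> of the two
    factors cancel here, because the rotations have squares \<open>\<i>\<close> and
    \<open>- \<i>\<close>. They survive in \<open>f3\<close>, attached to the antisymmetric
    combination \<open>W\<close>.\<close>
  define f2 where "f2 z = - t / 2 * (P z * Q z) + 2 * (P1 z * Q1 z)" for z
  define f3 where "f3 z = - t * f1 z + \<i> * q z / 2 * W z" for z
  define f4 where "f4 z = - t * f2 z + \<i> * q z / 4 * W z + (q z)^2 / 4 * f0 z" for z
  have d0: "(f0 has_field_derivative f1 z / z) (at z)"
    and d1: "(f1 has_field_derivative f2 z / z) (at z)"
    and d2: "(f2 has_field_derivative f3 z / z) (at z)"
    if "z \<in> - \<real>\<^sub>\<le>\<^sub>0" for z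
  proof -
    have z: "z \<notin> \<real>\<^sub>\<le>\<^sub>0" and nz: "z \<noteq> 0" using that by auto
    show "(f0 has_field_derivative f1 z / z) (at z)"
      unfolding f0_def[abs_def] f1_def
      by (auto intro!: derivative_eq_intros D[OF z] simp: nz field_simps)
    show "(f1 has_field_derivative f2 z / z) (at z)"
      unfolding f1_def[abs_def] f2_def
      by (auto intro!: derivative_eq_intros D[OF z] simp: nz field_simps)
    show "(f2 has_field_derivative f3 z / z) (at z)"
      unfolding f2_def[abs_def] f3_def f1_def W_def
      by (auto intro!: derivative_eq_intros D[OF z] simp: nz field_simps)
  qed
  have d3: "(f3 has_field_derivative f4 z / z) (at z)" if "z \<in> - \<real>\<^sub>\<le>\<^sub>0" for z
  proof -
    have z: "z \<notin> \<real>\<^sub>\<le>\<^sub>0" and nz: "z \<noteq> 0" using that by auto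
    have W: "(W has_field_derivative (- \<i> * q z / 2 * f0 z) / z) (at z)"
      unfolding W_def[abs_def] f0_def
      by (auto intro!: derivative_eq_intros D[OF z] simp: nz field_simps)
    show ?thesis
      unfolding f3_def[abs_def] f4_def
      by (auto intro!: derivative_eq_intros D[OF z] W d1[OF that] simp: nz field_simps power2_eq_square)
  qed
  have k0: "kernel_ext \<tau> = f0"
    by (simp add: fun_eq_iff kernel_ext_def f0_def P_def Q_def)
  have \<rho>S: "\<rho> \<in> - \<real>\<^sub>\<le>\<^sub>0" and nz: "\<rho> \<noteq> 0" and 0: "0 \<notin> - \<real>\<^sub>\<le>\<^sub>0" using \<rho> by auto
  note d = higher_deriv_of_euler_operator[OF open_slit_plane 0 d0 d1 d2 d3 \<rho>S]
  \<comment> \<open>\<open>f3\<close> and \<open>f4\<close> contain \<open>q W\<close> with factors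
    in the ratio 2 to 1, so half of \<open>f3 + t f1\<close> replaces that term in
    \<open>f4\<close>; the remaining \<open>q^2\<close> is linear in \<open>\<rho>\<close>.\<close>
  have "(q \<rho>)^2 = 4 * \<rho>" by (simp add: q_def)
  then have f4: "f4 \<rho> = - t * f2 \<rho> + (f3 \<rho> + t * f1 \<rho>) / 2 + \<rho> * f0 \<rho>"
    by (simp add: f4_def f3_def field_simps)
  have e0: "d 0 = f0 \<rho>" by (simp add: d_def k0)
  have e1: "d 1 = f1 \<rho> / \<rho>"
    unfolding d_def k0 by (rule d(1))
  have e2: "d 2 = (f2 \<rho> - f1 \<rho>) / \<rho> ^ 2"
    unfolding d_def k0 by (rule d(2))
  have e3: "d 3 = (f3 \<rho> - 3 * f2 \<rho> + 2 * f1 \<rho>) / \<rho> ^ 3"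
    unfolding d_def k0 by (rule d(3))
  have e4: "d 4 = (f4 \<rho> - 6 * f3 \<rho> + 11 * f2 \<rho> - 6 * f1 \<rho>) / \<rho> ^ 4"
    unfolding d_def k0 by (rule d(4))
  show ?thesis
    unfolding e0 e1 e2 e3 e4 t_def[symmetric] f4 using nz by (simp add: field_simps eval_nat_numeral)
qed


lemma kernel_ext_order_measurable:
  assumes "\<rho> \<notin> \<real>\<^sub>\<le>\<^sub>0"
  shows "(\<lambda>\<tau>. kernel_ext \<tau> \<rho>) \<in> borel_measurable borel"
  unfolding kernel_ext_def
  by (intro borel_measurable_times bessel_K_order_measurable kelvin_arg_cis_Re_pos assms) auto

subsection \<open>Integrals over the spectral parameter\<close>

text \<open>Lebesgue measure, not its Borel restriction: absolute integrability of \<open>g\<close>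
  is a statement about the completed measure.\<close>

abbreviation half_line :: "real measure" where
  "half_line \<equiv> lebesgue_on {0<..}"

lemma borel_measurable_half_line:
  "f \<in> borel_measurable borel \<Longrightarrow> f \<in> borel_measurable half_line"
  by (intro measurable_restrict_space1 measurable_completion) simp

text \<open>By continuity, the smaller of the two real parts exceeds half its value at
  \<open>\<rho>\<close> throughout a ball. Both Macdonald factors are then bounded there by a
  constant free of \<tau>, and a multiple of \<open>norm (h \<tau>)\<close> is the majorant.\<close>

lemma dominated_holomorphic_kernel_ext:
  fixes h :: "real \<Rightarrow> complex"
  assumes h: "integrable half_line h"
  shows "dominated_holomorphic half_line (- \<real>\<^sub>\<le>\<^sub>0) (\<lambda>\<rho> \<tau>. kernel_ext \<tau> \<rho> * h \<tau>)"
  unfolding dominated_holomorphic_def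
proof (intro conjI ballI)
  show "open (- \<real>\<^sub>\<le>\<^sub>0 :: complex set)" by (rule open_slit_plane)
  show "(\<lambda>\<rho>. kernel_ext \<tau> \<rho> * h \<tau>) holomorphic_on - \<real>\<^sub>\<le>\<^sub>0" for \<tau>
    by (intro holomorphic_intros kernel_ext_holomorphic)
  fix \<rho> :: complex assume \<rho>: "\<rho> \<in> - \<real>\<^sub>\<le>\<^sub>0"
  then have "(\<lambda>\<tau>. kernel_ext \<tau> \<rho>) \<in> borel_measurable half_line"
    by (intro borel_measurable_half_line kernel_ext_order_measurable) auto
  then show "(\<lambda>\<tau>. kernel_ext \<tau> \<rho> * h \<tau>) \<in> borel_measurable half_line"
    using borel_measurable_integrable[OF h] by (rule borel_measurable_times)
  define m where "m z = min (Re (kelvin_arg z * cis (pi / 4))) (Re (kelvin_arg z * cis (- pi / 4)))" for z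
  have "continuous_on (- \<real>\<^sub>\<le>\<^sub>0) kelvin_arg"
    by (intro continuous_at_imp_continuous_on ballI DERIV_isCont[OF kelvin_arg_has_field_derivative]) auto
  then have "continuous_on (- \<real>\<^sub>\<le>\<^sub>0) m"
    unfolding m_def[abs_def] by (intro continuous_intros)
  then have "open {z \<in> - \<real>\<^sub>\<le>\<^sub>0. m z \<in> {m \<rho> / 2<..}}"
    using continuous_open_preimage[OF _ open_slit_plane open_greaterThan, of m "m \<rho> / 2"]
    by (simp add: vimage_def Int_def)
  moreover have m: "m \<rho> > 0"
    using kelvin_arg_cis_Re_pos \<rho> by (simp add: m_def)
  ultimately obtain e where e: "e > 0" and sub: "ball \<rho> e \<subseteq> {z \<in> - \<real>\<^sub>\<le>\<^sub>0. m z \<in> {m \<rho> / 2<..}}"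
    using \<rho> by (auto elim!: openE[where x = \<rho>])
  define B where "B = (\<integral>y. indicat_real {0<..} y * exp (- (m \<rho> / 2) * y) \<partial>lborel)"
  have "norm (kernel_ext \<tau> z * h \<tau>) \<le> B * B * norm (h \<tau>)" if "z \<in> ball \<rho> e" for z \<tau>
  proof -
    have z: "m \<rho> / 2 < m z" using that sub by auto
    then have Re: "m \<rho> / 2 \<le> Re (kelvin_arg z * cis (pi / 4))" "m \<rho> / 2 \<le> Re (kelvin_arg z * cis (- pi / 4))"
      unfolding m_def[of z] by simp_all
    have K: "norm (bessel_K (2 * \<i> * of_real \<tau>) (kelvin_arg z * cis (pi / 4))) \<le> B"
      unfolding B_def using m by (intro norm_bessel_K_le Re) auto
    then have "0 \<le> B"
      by (rule order_trans[OF norm_ge_zero])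
    moreover have "norm (bessel_K (2 * \<i> * of_real \<tau>) (kelvin_arg z * cis (- pi / 4))) \<le> B"
      unfolding B_def using m by (intro norm_bessel_K_le Re) auto
    ultimately have "norm (kernel_ext \<tau> z) \<le> B * B"
      unfolding kernel_ext_def norm_mult using K by (intro mult_mono) auto
    then show ?thesis
      unfolding norm_mult by (rule mult_right_mono) simp
  qed
  moreover have "integrable half_line (\<lambda>\<tau>. B * B * norm (h \<tau>))"
    using h by simp
  ultimately show "\<exists>e>0. \<exists>k. integrable half_line k \<and> ball \<rho> e \<subseteq> - \<real>\<^sub>\<le>\<^sub>0 \<and>
      (\<forall>z\<in>ball \<rho> e. \<forall>\<tau>\<in>space half_line. norm (kernel_ext \<tau> z * h \<tau>) \<le> k \<tau>)"
    using e sub by (intro exI[of _ e] conjI exI[of _ "\<lambda>\<tau>. B * B * norm (h \<tau>)"]) auto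
qed

text \<open>The bound vanishes at \<open>z = 0\<close>, so that it survives division by
  \<open>sinh (\<beta> * \<tau>)\<close> as \<tau> tends to 0. It comes from the addition formula
  and from \<open>cosh x \<le> 1 + sinh \<bar>x\<bar>\<close>.\<close>

lemma norm_sinh_le: "norm (sinh z) \<le> 2 * sinh \<bar>Re z\<bar> + \<bar>Im z\<bar>"
proof -
  let ?x = "of_real (Re z) :: complex" and ?y = "\<i> * of_real (Im z)"
  have y: "norm (cosh ?y) \<le> 1" "norm (sinh ?y) \<le> 1"
    using norm_cosh_imaginary_le[of \<i> "Im z"] by simp_all
  have "sinh ?y = \<i> * of_real (sin (Im z))"
    by (simp add: sinh_conv_sin sin_of_real flip: mult.assoc)
  then have y': "norm (sinh ?y) \<le> \<bar>Im z\<bar>"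
    using abs_sin_x_le_abs_x[of "Im z"] by (simp add: norm_mult)
  have c: "cosh (Re z) \<le> 1 + sinh \<bar>Re z\<bar>"
  proof -
    have "cosh \<bar>Re z\<bar> - sinh \<bar>Re z\<bar> = exp (- \<bar>Re z\<bar>)"
      by (rule cosh_minus_sinh)
    moreover have "exp (- \<bar>Re z\<bar>) \<le> 1" by simp
    ultimately have "cosh \<bar>Re z\<bar> \<le> 1 + sinh \<bar>Re z\<bar>" by linarith
    then show ?thesis by (simp only: cosh_real_abs)
  qed
  have "sinh z = sinh (?x + ?y)"
    by (simp only: complex_eq[symmetric])
  also have "\<dots> = sinh ?x * cosh ?y + cosh ?x * sinh ?y"
    by (rule sinh_add)
  finally have "norm (sinh z) \<le> norm (sinh ?x * cosh ?y) + norm (cosh ?x * sinh ?y)"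
    by (simp add: norm_triangle_ineq)
  also have "norm (sinh ?x * cosh ?y) \<le> sinh \<bar>Re z\<bar> * 1"
    unfolding norm_mult cosh_sinh_of_real norm_of_real using y
    by (intro mult_mono) (auto simp: sinh_real_abs)
  also have "norm (cosh ?x * sinh ?y) \<le> (1 + sinh \<bar>Re z\<bar>) * norm (sinh ?y)"
    unfolding norm_mult cosh_sinh_of_real norm_of_real using c
    by (intro mult_right_mono) auto
  \<comment> \<open>Two bounds on the same factor: \<open>\<bar>Im z\<bar>\<close> where it
    multiplies 1, and 1 where it multiplies \<open>sinh \<bar>Re z\<bar>\<close>.\<close>
  also have "\<dots> \<le> \<bar>Im z\<bar> + sinh \<bar>Re z\<bar>"
    using mult_left_mono[OF y(2), of "sinh \<bar>Re z\<bar>"] y' by (simp add: distrib_right)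
  finally show ?thesis by simp
qed

text \<open>The angle is complex so that Cauchy's estimates control the derivatives in it.\<close>

definition sinh_ratio :: "real \<Rightarrow> complex \<Rightarrow> real \<Rightarrow> complex" where
  "sinh_ratio \<beta> \<theta> \<tau> = sinh (\<theta> * of_real \<tau>) / of_real (sinh (\<beta> * \<tau>))"

lemma norm_sinh_ratio_le:
  assumes "0 < \<beta>" "\<bar>Re \<theta>\<bar> \<le> \<beta>" "0 < \<tau>"
  shows "norm (sinh_ratio \<beta> \<theta> \<tau>) \<le> 2 + \<bar>Im \<theta>\<bar> / \<beta>"
proof -
  have pos: "sinh (\<beta> * \<tau>) > 0" using assms by simp
  have "norm (sinh (\<theta> * of_real \<tau>)) \<le> 2 * sinh \<bar>Re (\<theta> * of_real \<tau>)\<bar> + \<bar>Im (\<theta> * of_real \<tau>)\<bar>"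
    by (rule norm_sinh_le)
  also have "\<dots> = 2 * sinh (\<bar>Re \<theta>\<bar> * \<tau>) + \<bar>Im \<theta>\<bar> / \<beta> * (\<beta> * \<tau>)"
    using assms by (simp add: abs_mult)
  also have "\<dots> \<le> 2 * sinh (\<beta> * \<tau>) + \<bar>Im \<theta>\<bar> / \<beta> * sinh (\<beta> * \<tau>)"
    using assms sinh_ge_self[of "\<beta> * \<tau>"]
    by (intro add_mono mult_left_mono) (auto intro!: mult_right_mono)
  finally show ?thesis
    using pos by (simp add: sinh_ratio_def norm_divide pos_divide_le_eq distrib_right)
qed

lemma sinh_ratio_measurable: "sinh_ratio \<beta> \<theta> \<in> borel_measurable borel"
proof -
  have [measurable]: "(\<lambda>x. sinh (x::complex)) \<in> borel_measurable borel" "(\<lambda>x. sinh (x::real)) \<in> borel_measurable borel"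
    by (intro borel_measurable_continuous_onI continuous_intros)+
  have "(\<lambda>\<tau>. sinh_ratio \<beta> \<theta> \<tau>) \<in> borel_measurable borel"
    unfolding sinh_ratio_def by measurable
  then show ?thesis by simp
qed

lemma integrable_sinh_ratio:
  fixes h :: "real \<Rightarrow> complex"
  assumes "0 < \<beta>" "\<bar>Re \<theta>\<bar> \<le> \<beta>" and h: "integrable half_line h"
  shows "integrable half_line (\<lambda>\<tau>. sinh_ratio \<beta> \<theta> \<tau> * h \<tau>)"
proof (rule Bochner_Integration.integrable_bound)
  show "integrable half_line (\<lambda>\<tau>. (2 + \<bar>Im \<theta>\<bar> / \<beta>) * norm (h \<tau>))"
    using h by simp
  show "(\<lambda>\<tau>. sinh_ratio \<beta> \<theta> \<tau> * h \<tau>) \<in> borel_measurable half_line"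
    using borel_measurable_half_line[OF sinh_ratio_measurable] borel_measurable_integrable[OF h]
    by (rule borel_measurable_times)
  show "AE \<tau> in half_line. norm (sinh_ratio \<beta> \<theta> \<tau> * h \<tau>) \<le> norm ((2 + \<bar>Im \<theta>\<bar> / \<beta>) * norm (h \<tau>))"
  proof (rule AE_I2)
    fix \<tau> assume "\<tau> \<in> space half_line"
    then have "norm (sinh_ratio \<beta> \<theta> \<tau>) \<le> 2 + \<bar>Im \<theta>\<bar> / \<beta>"
      using assms by (intro norm_sinh_ratio_le) auto
    then have "norm (sinh_ratio \<beta> \<theta> \<tau> * h \<tau>) \<le> (2 + \<bar>Im \<theta>\<bar> / \<beta>) * norm (h \<tau>)"
      unfolding norm_mult by (rule mult_right_mono) simp
    then show "norm (sinh_ratio \<beta> \<theta> \<tau> * h \<tau>) \<le> norm ((2 + \<bar>Im \<theta>\<bar> / \<beta>) * norm (h \<tau>))"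
      unfolding real_norm_def by (rule order_trans[OF _ abs_ge_self])
  qed
qed

text \<open>Within a ball of radius \<open>e\<close> the imaginary part grows by at most
  \<open>e\<close>, so one constant multiple of \<open>norm (h \<tau>)\<close> dominates.\<close>

lemma dominated_holomorphic_sinh_ratio:
  fixes h :: "real \<Rightarrow> complex"
  assumes \<beta>: "0 < \<beta>" and h: "integrable half_line h"
  shows "dominated_holomorphic half_line {\<theta>. \<bar>Re \<theta>\<bar> < \<beta>} (\<lambda>\<theta> \<tau>. sinh_ratio \<beta> \<theta> \<tau> * h \<tau>)"
  unfolding dominated_holomorphic_def
proof (intro conjI ballI)
  let ?S = "{\<theta>::complex. \<bar>Re \<theta>\<bar> < \<beta>}"
  have S: "open ?S"
    by (intro open_Collect_less continuous_intros)
  then show "open ?S" .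
  show "(\<lambda>\<theta>. sinh_ratio \<beta> \<theta> \<tau> * h \<tau>) holomorphic_on ?S" for \<tau>
    unfolding sinh_ratio_def sinh_field_def divide_inverse by (intro holomorphic_intros)
  fix \<theta> assume \<theta>: "\<theta> \<in> ?S"
  then show "(\<lambda>\<tau>. sinh_ratio \<beta> \<theta> \<tau> * h \<tau>) \<in> borel_measurable half_line"
    using \<beta> h by (intro borel_measurable_integrable integrable_sinh_ratio) auto
  obtain e where e: "e > 0" "ball \<theta> e \<subseteq> ?S"
    using S \<theta> openE by blast
  let ?k = "\<lambda>\<tau>. (2 + (\<bar>Im \<theta>\<bar> + e) / \<beta>) * norm (h \<tau>)"
  have "norm (sinh_ratio \<beta> w \<tau> * h \<tau>) \<le> ?k \<tau>" if w: "w \<in> ball \<theta> e" and \<tau>: "\<tau> \<in> space half_line" for w \<tau>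
  proof -
    have "\<bar>Im w\<bar> \<le> \<bar>Im \<theta>\<bar> + e"
      using w abs_Im_le_cmod[of "\<theta> - w"] by (simp add: dist_norm)
    then have "2 + \<bar>Im w\<bar> / \<beta> \<le> 2 + (\<bar>Im \<theta>\<bar> + e) / \<beta>"
      using \<beta> by (intro add_left_mono divide_right_mono) auto
    moreover have "norm (sinh_ratio \<beta> w \<tau>) \<le> 2 + \<bar>Im w\<bar> / \<beta>"
      using w e \<tau> \<beta> by (intro norm_sinh_ratio_le) (auto intro: less_imp_le)
    ultimately show ?thesis
      unfolding norm_mult by (intro mult_right_mono) auto
  qed
  moreover have "integrable half_line ?k"
    using h by simp
  ultimately show "\<exists>e>0. \<exists>k. integrable half_line k \<and> ball \<theta> e \<subseteq> ?S \<and>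
      (\<forall>w\<in>ball \<theta> e. \<forall>\<tau>\<in>space half_line. norm (sinh_ratio \<beta> w \<tau> * h \<tau>) \<le> k \<tau>)"
    using e by (intro exI[of _ e] conjI exI[of _ ?k] ballI)
qed

lemma second_deriv_sinh_ratio:
  "(deriv ^^ 2) (\<lambda>\<theta>. sinh_ratio \<beta> \<theta> \<tau> * c) \<theta> = of_real (\<tau>^2) * (sinh_ratio \<beta> \<theta> \<tau> * c)"
proof -
  let ?d = "\<lambda>\<theta>. cosh (\<theta> * of_real \<tau>) * of_real \<tau> * (inverse (of_real (sinh (\<beta> * \<tau>))) * c)"
  have d: "deriv (\<lambda>\<theta>. sinh_ratio \<beta> \<theta> \<tau> * c) = ?d"
    unfolding sinh_ratio_def divide_inverse mult.assoc[of _ _ c]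
    by (rule ext, rule DERIV_imp_deriv) (auto intro!: derivative_eq_intros)
  have "deriv ?d \<theta> = of_real (\<tau>^2) * (sinh_ratio \<beta> \<theta> \<tau> * c)"
    by (rule DERIV_imp_deriv)
       (auto intro!: derivative_eq_intros simp: sinh_ratio_def divide_inverse power2_eq_square)
  then show ?thesis
    unfolding numeral_2_eq_2 funpow.simps o_apply id_apply d .
qed

section \<open>Passage from gauge integrals and real derivatives to Bochner integrals and complex
  derivatives\<close>

lemma absolutely_integrable_half_line_iff:
  fixes f :: "real \<Rightarrow> complex"
  shows "f absolutely_integrable_on {0<..} \<longleftrightarrow> integrable half_line f"
  by (simp add: set_integrable_def integrable_restrict_space)

text \<open>A complex derivative at a real point is also the derivative along the real axis, and
  agreement on a real neighbourhood suffices.\<close>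

lemma has_vector_derivative_of_holomorphic_extension:
  assumes "F holomorphic_on S" "open S" "of_real x \<in> S" "open T" "x \<in> T"
    and "\<And>y. y \<in> T \<Longrightarrow> f y = F (of_real y)"
  shows "(f has_vector_derivative deriv F (of_real x)) (at x)"
  using has_vector_derivative_real_field[OF holomorphic_derivI[OF assms(1-3)]] assms(4,5)
  by (rule has_vector_derivative_transform_within_open) (simp add: assms(6))

text \<open>The equality holds on the open set of all positive radii, so it can be differentiated
  again; differentiability comes from the same step.\<close>

lemma iterated_pd_r:
  assumes F: "F holomorphic_on - \<real>\<^sub>\<le>\<^sub>0"
    and v: "\<And>r. r > 0 \<Longrightarrow> v r \<theta> = F (of_real r)" and r: "r > 0"
  shows "(pd_r ^^ i) v r \<theta> = (deriv ^^ i) F (of_real r)"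
    and "(\<lambda>\<rho>. (pd_r ^^ i) v \<rho> \<theta>) differentiable at r"
proof -
  \<comment> \<open>The equality of order \<open>i\<close> is a premise here, so that
    \<open>D\<close> serves both the induction step and, afterwards, the differentiability
    claim.\<close>
  have D: "((\<lambda>\<rho>. (pd_r ^^ i) v \<rho> \<theta>) has_vector_derivative deriv ((deriv ^^ i) F) (of_real r)) (at r)"
    if eq: "\<And>r. r > 0 \<Longrightarrow> (pd_r ^^ i) v r \<theta> = (deriv ^^ i) F (of_real r)" and r: "r > 0" for i r
    using r eq
    by (intro has_vector_derivative_of_holomorphic_extension
        [OF holomorphic_higher_deriv[OF F open_slit_plane] open_slit_plane _ open_greaterThan]) auto
  have eq: "(pd_r ^^ i) v r \<theta> = (deriv ^^ i) F (of_real r)" if "r > 0" for r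
    using that
  proof (induction i arbitrary: r)
    case (Suc i)
    show ?case
      using vector_derivative_at[OF D[OF Suc.IH Suc.prems]] by (simp add: pd_r_def[of "(pd_r ^^ i) v"])
  qed (simp add: v)
  then show "(pd_r ^^ i) v r \<theta> = (deriv ^^ i) F (of_real r)" using r .
  show "(\<lambda>\<rho>. (pd_r ^^ i) v \<rho> \<theta>) differentiable at r"
    using D[OF eq r] by (rule differentiableI_vector)
qed

text \<open>The extension lives on a strip around the imaginary axis, but agreement with it is asked
  only on the open interval where the derivatives are taken.\<close>

lemma iterated_pd_\<theta>:
  assumes F: "F holomorphic_on {\<theta>. \<bar>Re \<theta>\<bar> < \<beta>}"
    and v: "\<And>\<theta>. 0 < \<theta> \<Longrightarrow> \<theta> < \<beta> \<Longrightarrow> v r \<theta> = F (of_real \<theta>)" and \<theta>: "0 < \<theta>" "\<theta> < \<beta>"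
  shows "(pd_\<theta> ^^ j) v r \<theta> = (deriv ^^ j) F (of_real \<theta>)"
    and "(\<lambda>\<phi>. (pd_\<theta> ^^ j) v r \<phi>) differentiable at \<theta>"
proof -
  have S: "open {\<theta>::complex. \<bar>Re \<theta>\<bar> < \<beta>}"
    by (intro open_Collect_less continuous_intros)
  have D: "((\<lambda>\<phi>. (pd_\<theta> ^^ j) v r \<phi>) has_vector_derivative deriv ((deriv ^^ j) F) (of_real \<theta>)) (at \<theta>)"
    if eq: "\<And>\<theta>. 0 < \<theta> \<Longrightarrow> \<theta> < \<beta> \<Longrightarrow> (pd_\<theta> ^^ j) v r \<theta> = (deriv ^^ j) F (of_real \<theta>)"
      and "0 < \<theta>" "\<theta> < \<beta>" for j \<theta>
    using that
    by (intro has_vector_derivative_of_holomorphic_extension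
        [OF holomorphic_higher_deriv[OF F S] S _ open_greaterThanLessThan[of 0 \<beta>]]) auto
  have eq: "(pd_\<theta> ^^ j) v r \<theta> = (deriv ^^ j) F (of_real \<theta>)" if "0 < \<theta>" "\<theta> < \<beta>" for \<theta>
    using that
  proof (induction j arbitrary: \<theta>)
    case (Suc j)
    show ?case
      using vector_derivative_at[OF D[OF Suc.IH Suc.prems]] by (simp add: pd_\<theta>_def[of "(pd_\<theta> ^^ j) v"])
  qed (simp add: v)
  then show "(pd_\<theta> ^^ j) v r \<theta> = (deriv ^^ j) F (of_real \<theta>)" using \<theta> .
  show "(\<lambda>\<phi>. (pd_\<theta> ^^ j) v r \<phi>) differentiable at \<theta>"
    using D[OF eq \<theta>] by (rule differentiableI_vector)
qed

text \<open>The weight does not depend on \<open>\<rho>\<close>, so every derivative falls on the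
  kernel. Two weights will be inserted, one for \<open>u\<close> and one for its second
  \<theta>-derivative.\<close>

lemma kernel_superposition:
  fixes h :: "real \<Rightarrow> complex"
  assumes h: "integrable half_line h"
  defines "F \<equiv> \<lambda>\<rho>. \<integral>\<tau>. kernel_ext \<tau> \<rho> * h \<tau> \<partial>half_line"
  shows "F holomorphic_on - \<real>\<^sub>\<le>\<^sub>0"
    and "\<rho> \<notin> \<real>\<^sub>\<le>\<^sub>0 \<Longrightarrow> integrable half_line (\<lambda>\<tau>. (deriv ^^ n) (kernel_ext \<tau>) \<rho> * h \<tau>)"
    and "\<rho> \<notin> \<real>\<^sub>\<le>\<^sub>0 \<Longrightarrow> (deriv ^^ n) F \<rho> = (\<integral>\<tau>. (deriv ^^ n) (kernel_ext \<tau>) \<rho> * h \<tau> \<partial>half_line)"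
proof -
  note dom = dominated_holomorphic_kernel_ext[OF h]
  show "F holomorphic_on - \<real>\<^sub>\<le>\<^sub>0"
    unfolding F_def by (rule dominated_holomorphic_holomorphic_integral[OF dom])
  assume "\<rho> \<notin> \<real>\<^sub>\<le>\<^sub>0"
  then have \<rho>: "\<rho> \<in> - \<real>\<^sub>\<le>\<^sub>0" by simp
  have "(deriv ^^ n) (\<lambda>w. kernel_ext \<tau> w * h \<tau>) \<rho> = (deriv ^^ n) (kernel_ext \<tau>) \<rho> * h \<tau>" for \<tau>
    using higher_deriv_cmult[OF kernel_ext_holomorphic \<rho> open_slit_plane] by (simp add: mult.commute[of _ "h \<tau>"])
  then show "integrable half_line (\<lambda>\<tau>. (deriv ^^ n) (kernel_ext \<tau>) \<rho> * h \<tau>)"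
    and "(deriv ^^ n) F \<rho> = (\<integral>\<tau>. (deriv ^^ n) (kernel_ext \<tau>) \<rho> * h \<tau> \<partial>half_line)"
    using dominated_holomorphic_integrable[OF dominated_holomorphic_higher_deriv[OF dom] \<rho>, of n]
      higher_deriv_integral[OF dom \<rho>, of n]
    unfolding F_def by simp_all
qed

subsection \<open>The boundary value problem\<close>

theorem theorem6:
  fixes \<beta> \<mu> \<gamma> :: real
    and g Gstar :: "complex \<Rightarrow> complex"
    and G :: "real \<Rightarrow> complex"
    and u :: "real \<Rightarrow> real \<Rightarrow> complex"
  assumes beta: "0 < \<beta>" "\<beta> < 2 * pi"
    and mu: "0 < \<mu>" "\<mu> < 1 / 2"
    and G_differentiable: "\<And>t. t > 0 \<Longrightarrow> G differentiable at t"
    and g_integral: "\<And>x. x > 0 \<Longrightarrow>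
          (\<lambda>t. of_real (Im (Gamma (1 + 2 * \<i> * of_real x) * kernel_B x t))
                 * vector_derivative G (at t)) integrable_on {0<..}"
    and g_eq: "\<And>x. x > 0 \<Longrightarrow>
          g (of_real x) = - of_real (16 * x / pi) *
            integral {0<..} (\<lambda>t. of_real (Im (Gamma (1 + 2 * \<i> * of_real x) * kernel_B x t))
                 * vector_derivative G (at t))"
    and G_eq: "\<And>t. t > 0 \<Longrightarrow>
          G t = integral {0<..} (\<lambda>\<tau>. kernel_K \<tau> t * g (of_real \<tau>))"
    \<comment> \<open>(i)\<close>
    and g_analytic: "(\<lambda>z. g (z / \<i>)) analytic_on vstrip \<mu>"
    and g_even: "\<And>z. z \<in> vstrip \<mu> \<Longrightarrow> g ((- z) / \<i>) = g (z / \<i>)"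
    and g_zero: "g 0 = 0" "deriv g 0 = 0"
    and g_lines: "\<And>\<nu>. \<bar>\<nu>\<bar> \<le> \<mu> \<Longrightarrow>
          abs_integrable_on_line (\<lambda>z. of_real (exp (- 3 * pi * \<bar>Im z\<bar> / 2)) * g (z / \<i>)) \<nu>"
    \<comment> \<open>(ii)\<close>
    and g_L1: "(\<lambda>\<tau>. g (of_real \<tau>)) absolutely_integrable_on {0<..}"
    and gamma: "0 < \<gamma>" "\<gamma> < 1 / 2" "{s. Re s = \<gamma>} \<subseteq> vstrip \<mu>"
    and G_L1: "G \<in> L_weighted \<gamma>"
    \<comment> \<open>(iii)\<close>
    and Gstar_eq: "\<And>s. Re s = \<gamma> \<Longrightarrow> Gstar s = mellin G s"
    and Gstar_analytic: "Gstar analytic_on vstrip \<mu>"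
    and Gstar_lines: "\<And>\<nu>. \<bar>\<nu>\<bar> \<le> \<mu> \<Longrightarrow>
          abs_integrable_on_line
            (\<lambda>s. of_real (norm s powr (1 / 2 - 2 * \<nu>) * exp (pi * norm s / 2)) * Gstar s) \<nu>"
    and u_eq: "\<And>r \<theta>. r > 0 \<Longrightarrow> 0 \<le> \<theta> \<Longrightarrow> \<theta> \<le> \<beta> \<Longrightarrow>
          u r \<theta> = integral {0<..}
            (\<lambda>\<tau>. kernel_K \<tau> r * of_real (sinh (\<theta> * \<tau>) / sinh (\<beta> * \<tau>)) * g (of_real \<tau>))"
  shows "(\<forall>r \<theta>. 0 < r \<and> 0 \<le> \<theta> \<and> \<theta> \<le> \<beta> \<longrightarrow>
            (\<lambda>\<tau>. kernel_K \<tau> r * of_real (sinh (\<theta> * \<tau>) / sinh (\<beta> * \<tau>)) * g (of_real \<tau>))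
              absolutely_integrable_on {0<..}) \<and>
         solves_pde \<beta> u \<and>
         (\<forall>r>0. u r 0 = 0) \<and>
         (\<forall>r>0. u r \<beta> = G r)"
proof -
  define h where "h \<tau> = g (of_real \<tau>)" for \<tau> :: real
  \<comment> \<open>For fixed \<theta>, everything except the kernel is an integrable weight in
    \<tau>.\<close>
  define k where "k \<theta> \<tau> = sinh_ratio \<beta> (of_real \<theta>) \<tau> * h \<tau>" for \<theta> \<tau>
  have h: "integrable half_line h"
    using g_L1 unfolding absolutely_integrable_half_line_iff h_def .
  have k: "integrable half_line (k \<theta>)" if "0 \<le> \<theta>" "\<theta> \<le> \<beta>" for \<theta>
    unfolding k_def[abs_def] using that beta by (intro integrable_sinh_ratio h) auto
  have int: "integrable half_line (\<lambda>\<tau>. kernel_ext \<tau> (of_real r) * k \<theta> \<tau>)"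
    if "r > 0" "0 \<le> \<theta>" "\<theta> \<le> \<beta>" for r \<theta>
    using that by (intro dominated_holomorphic_integrable[OF dominated_holomorphic_kernel_ext] k) auto
  have integrand: "kernel_K \<tau> r * of_real (sinh (\<theta> * \<tau>) / sinh (\<beta> * \<tau>)) * g (of_real \<tau>) =
      kernel_ext \<tau> (of_real r) * k \<theta> \<tau>" if "r > 0" for r \<theta> \<tau>
    using kernel_K_eq_kernel_ext[OF that]
    by (simp add: k_def h_def sinh_ratio_def flip: cosh_sinh_of_real)
  have abs_int: "(\<lambda>\<tau>. kernel_K \<tau> r * of_real (sinh (\<theta> * \<tau>) / sinh (\<beta> * \<tau>)) * g (of_real \<tau>))
      absolutely_integrable_on {0<..}" if "r > 0" "0 \<le> \<theta>" "\<theta> \<le> \<beta>" for r \<theta>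
    unfolding absolutely_integrable_half_line_iff integrand[OF that(1)] by (rule int[OF that])
  have u: "u r \<theta> = (\<integral>\<tau>. kernel_ext \<tau> (of_real r) * k \<theta> \<tau> \<partial>half_line)"
    if "r > 0" "0 \<le> \<theta>" "\<theta> \<le> \<beta>" for r \<theta>
    unfolding u_eq[OF that] integrand[OF that(1)]
    by (rule lebesgue_integral_eq_integral[OF int[OF that], symmetric]) simp
  have u0: "u r 0 = 0" if "r > 0" for r
    using u[OF that] beta by (simp add: k_def sinh_ratio_def)
  \<comment> \<open>For \<tau> > 0 the denominator is nonzero and the quotient is exactly 1, which
    leaves the integral for \<open>G\<close>.\<close>
  have u\<beta>: "u r \<beta> = G r" if "r > 0" for r
    unfolding u_eq[OF that less_imp_le[OF beta(1)] order_refl] G_eq[OF that]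
    using beta by (intro integral_cong) auto

  define U where "U \<theta> \<rho> = (\<integral>\<tau>. kernel_ext \<tau> \<rho> * k \<theta> \<tau> \<partial>half_line)" for \<theta> \<rho>
  \<comment> \<open>\<open>V\<close> continues the second \<theta>-derivative of \<open>u\<close> to
    complex radius, as \<open>U\<close> continues \<open>u\<close> itself.\<close>
  define V where "V \<theta> \<rho> = (\<integral>\<tau>. kernel_ext \<tau> \<rho> * (of_real (\<tau>^2) * k \<theta> \<tau>) \<partial>half_line)" for \<theta> \<rho>
  let ?S = "{\<theta>::complex. \<bar>Re \<theta>\<bar> < \<beta>}"
  have \<theta>S: "of_real \<theta> \<in> ?S" if "0 < \<theta>" "\<theta> < \<beta>" for \<theta> :: real
    using that by simp
  \<comment> \<open>The factor \<open>\<tau>^2\<close> is absorbed by Cauchy's estimates: this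
    weight is the second \<theta>-derivative of a dominated family, at a point of the open
    strip.\<close>
  have k2: "integrable half_line (\<lambda>\<tau>. of_real (\<tau>^2) * k \<theta> \<tau>)" if "0 < \<theta>" "\<theta> < \<beta>" for \<theta>
    using dominated_holomorphic_integrable[OF dominated_holomorphic_higher_deriv
        [OF dominated_holomorphic_sinh_ratio[OF beta(1) h], of 2] \<theta>S[OF that]]
    unfolding second_deriv_sinh_ratio k_def .
  note U = kernel_superposition[OF k, folded U_def]
  note V = kernel_superposition[OF k2, folded V_def]
  have \<theta>_deriv: "(pd_\<theta> ^^ 2) u r \<theta> = V \<theta> (of_real r)"
      "\<And>j. (\<lambda>\<phi>. (pd_\<theta> ^^ j) u r \<phi>) differentiable at \<theta>"
    if r: "r > 0" and \<theta>: "0 < \<theta>" "\<theta> < \<beta>" for r \<theta>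
  proof -
    \<comment> \<open>The roles are exchanged: the radius is frozen, the kernel joins the weight,
      and the angle becomes the complex variable.\<close>
    define H where "H \<theta> = (\<integral>\<tau>. sinh_ratio \<beta> \<theta> \<tau> * (kernel_ext \<tau> (of_real r) * h \<tau>) \<partial>half_line)" for \<theta>
    have "integrable half_line (\<lambda>\<tau>. kernel_ext \<tau> (of_real r) * h \<tau>)"
      using r by (intro dominated_holomorphic_integrable[OF dominated_holomorphic_kernel_ext] h) auto
    note dom = dominated_holomorphic_sinh_ratio[OF beta(1) this]
    have H: "H holomorphic_on ?S"
      unfolding H_def[abs_def] by (rule dominated_holomorphic_holomorphic_integral[OF dom])
    have uH: "u r \<theta> = H (of_real \<theta>)" if "0 < \<theta>" "\<theta> < \<beta>" for \<theta>
      using u[OF r, of \<theta>] that by (simp add: H_def k_def mult_ac)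
    have "(deriv ^^ 2) H (of_real \<theta>) = V \<theta> (of_real r)"
      unfolding H_def[abs_def] higher_deriv_integral[OF dom \<theta>S[OF \<theta>]] second_deriv_sinh_ratio V_def k_def
      by (simp only: mult_ac)
    then show "(pd_\<theta> ^^ 2) u r \<theta> = V \<theta> (of_real r)"
      using iterated_pd_\<theta>(1)[where v = u and r = r, OF H uH \<theta>] by simp
    show "(\<lambda>\<phi>. (pd_\<theta> ^^ j) u r \<phi>) differentiable at \<theta>" for j
      by (rule iterated_pd_\<theta>(2)[where v = u and r = r, OF H uH \<theta>])
  qed
  have "solves_pde \<beta> u"
    unfolding solves_pde_def
  proof (intro allI impI, elim conjE)
    fix r \<theta> :: real
    assume r: "0 < r" and \<theta>: "0 < \<theta>" "\<theta> < \<beta>"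
    have \<theta>': "0 \<le> \<theta>" "\<theta> \<le> \<beta>" using \<theta> by auto
    have slit: "complex_of_real r \<notin> \<real>\<^sub>\<le>\<^sub>0" using r by simp
    have uU: "u r \<theta> = U \<theta> (of_real r)" if "r > 0" for r
      unfolding U_def by (rule u[OF that \<theta>'])
    have vV: "((pd_\<theta> ^^ 2) u) r \<theta> = V \<theta> (of_real r)" if "r > 0" for r
      by (rule \<theta>_deriv(1)[OF that \<theta>])
    define d where "d n \<tau> = (deriv ^^ n) (kernel_ext \<tau>) (of_real r)" for n \<tau>
    \<comment> \<open>\<open>A\<close> and \<open>B\<close> record integrability together with the
      value, so that the combination of derivatives in the equation becomes one integral of the
      combined integrands.\<close>
    have A: "has_bochner_integral half_line (\<lambda>\<tau>. d i \<tau> * k \<theta> \<tau>) (pd i 0 u r \<theta>)" for i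
      using iterated_pd_r(1)[where v = u and \<theta> = \<theta> and i = i, OF U(1)[OF \<theta>'] uU r]
        U(2,3)[OF \<theta>' slit, of i]
      by (simp add: has_bochner_integral_iff pd_def d_def)
    have B: "has_bochner_integral half_line (\<lambda>\<tau>. d i \<tau> * (of_real (\<tau>^2) * k \<theta> \<tau>)) (pd i 2 u r \<theta>)" for i
      using iterated_pd_r(1)[where v = "(pd_\<theta> ^^ 2) u" and \<theta> = \<theta> and i = i, OF V(1)[OF \<theta>] vV r]
        V(2,3)[OF \<theta> slit, of i]
      unfolding has_bochner_integral_iff pd_def d_def by simp
    let ?r = "complex_of_real r"
    \<comment> \<open>The combined integrand vanishes for each \<tau>: it is the ordinary
      differential equation of the kernel times the weight.\<close>
    have "?r ^ 3 * (d 4 \<tau> * k \<theta> \<tau>) + ?r * (d 2 \<tau> * (of_real (\<tau>^2) * k \<theta> \<tau>))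
        + 11 / 2 * ?r ^ 2 * (d 3 \<tau> * k \<theta> \<tau>) + 1 / 2 * (d 1 \<tau> * (of_real (\<tau>^2) * k \<theta> \<tau>))
        + 11 / 2 * ?r * (d 2 \<tau> * k \<theta> \<tau>) + 1 / 2 * (d 1 \<tau> * k \<theta> \<tau>) - d 0 \<tau> * k \<theta> \<tau> = 0" for \<tau>
    proof -
      have "(?r ^ 3 * d 4 \<tau> + of_real (\<tau>^2) * (?r * d 2 \<tau> + 1 / 2 * d 1 \<tau>)
        + 11 / 2 * ?r ^ 2 * d 3 \<tau> + 11 / 2 * ?r * d 2 \<tau> + 1 / 2 * d 1 \<tau> - d 0 \<tau>) * k \<theta> \<tau> = 0"
        unfolding d_def kernel_ext_ode[OF slit] by simp
      then show ?thesis by (simp add: algebra_simps)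
    qed
    moreover have "has_bochner_integral half_line (\<lambda>\<tau>.
        ?r ^ 3 * (d 4 \<tau> * k \<theta> \<tau>) + ?r * (d 2 \<tau> * (of_real (\<tau>^2) * k \<theta> \<tau>))
        + 11 / 2 * ?r ^ 2 * (d 3 \<tau> * k \<theta> \<tau>) + 1 / 2 * (d 1 \<tau> * (of_real (\<tau>^2) * k \<theta> \<tau>))
        + 11 / 2 * ?r * (d 2 \<tau> * k \<theta> \<tau>) + 1 / 2 * (d 1 \<tau> * k \<theta> \<tau>) - d 0 \<tau> * k \<theta> \<tau>)
       (?r ^ 3 * pd 4 0 u r \<theta> + ?r * pd 2 2 u r \<theta> + 11 / 2 * ?r ^ 2 * pd 3 0 u r \<theta>
        + 1 / 2 * pd 1 2 u r \<theta> + 11 / 2 * ?r * pd 2 0 u r \<theta> + 1 / 2 * pd 1 0 u r \<theta> - pd 0 0 u r \<theta>)"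
      by (intro has_bochner_integral_diff has_bochner_integral_add has_bochner_integral_mult_right A B)
    ultimately have lin: "?r ^ 3 * pd 4 0 u r \<theta> + ?r * pd 2 2 u r \<theta> + 11 / 2 * ?r ^ 2 * pd 3 0 u r \<theta>
        + 1 / 2 * pd 1 2 u r \<theta> + 11 / 2 * ?r * pd 2 0 u r \<theta> + 1 / 2 * pd 1 0 u r \<theta> - pd 0 0 u r \<theta> = 0"
      by (simp only: has_bochner_integral_iff integral_zero Bochner_Integration.integral_zero)
    show "(\<forall>i<4. (\<lambda>\<rho>. pd i 0 u \<rho> \<theta>) differentiable at r) \<and>
     (\<forall>j<2. (\<lambda>\<phi>. pd 0 j u r \<phi>) differentiable at \<theta>) \<and>
     (\<forall>i<2. (\<lambda>\<rho>. pd i 2 u \<rho> \<theta>) differentiable at r) \<and>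
     of_real (r ^ 3) * pd 4 0 u r \<theta>
       + of_real r * pd 2 2 u r \<theta>
       + 11 / 2 * of_real (r ^ 2) * pd 3 0 u r \<theta>
       + 1 / 2 * pd 1 2 u r \<theta>
       + 11 / 2 * of_real r * pd 2 0 u r \<theta>
       + 1 / 2 * pd 1 0 u r \<theta>
       - u r \<theta> = 0"
    proof (intro conjI allI impI)
      show "(\<lambda>\<rho>. pd i 0 u \<rho> \<theta>) differentiable at r" for i
        using iterated_pd_r(2)[where v = u and \<theta> = \<theta> and i = i, OF U(1)[OF \<theta>'] uU r] by (simp add: pd_def)
      show "(\<lambda>\<phi>. pd 0 j u r \<phi>) differentiable at \<theta>" for j
        using \<theta>_deriv(2)[OF r \<theta>, of j] by (simp add: pd_def)
      show "(\<lambda>\<rho>. pd i 2 u \<rho> \<theta>) differentiable at r" for i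
        unfolding pd_def
        by (rule iterated_pd_r(2)[where v = "(pd_\<theta> ^^ 2) u", OF V(1)[OF \<theta>] vV r])
    qed (use lin in \<open>simp add: pd_def[of 0 0]\<close>)
  qed
  then show ?thesis
    using abs_int u0 u\<beta> by blast
qed

end
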